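(* Let the graphs $G_i$, $G=\bigsqcup_iG_i$, the even integer $j$, $\sigma>0$ and $p\ge2$ be as in the context, and let $\alpha$ be a labeling for which property $(\mathrm P_p)$ holds. Let $(Y,d_Y)$ be a complete geodesic $p$-uniformly convex metric space such that $\Lambda^{(p)}_Y(\sigma)<\infty$ or, more generally, $$\lim_{N\to\infty}\Big(\frac{\log\log N}{\log N}\Big)^{\frac1{2p}}\Lambda^{(p)}_Y(\sigma,N)=0.$$ Then every isometric action of $\Gamma_\alpha$ on $Y$ fixes a point.
   Context: $\{G_i\}$: connected non-bipartite finite graphs on $N_i\to\infty$ vertices, degrees in $[3,d]$, spectral gaps $\ge\sigma$, girths $\ge c\log N_i$. $\Gamma$ is free on a symmetric set $S$ of size $2k$, $X=\mathrm{Cay}(\Gamma,S)$, $\mu_X(x\to xs)=\frac1{2k}$, $\mu_X^n$ its convolution powers. A labeling $\alpha$ assigns to each oriented edge of $G$ an element of $S^j$ (word of length $j$) with reverse edges getting inverses; $\Gamma_\alpha$ is the quotient of $\Gamma$ by the normal closure of the products of labels along cycles of $G$. $\Gamma$ acts on $Y$ via $\Gamma\to\Gamma_\alpha$; $B(X,Y)$ = $\Gamma$-equivariant maps $X\to Y$; $\mathcal E^{(p)}_\eta(f)=\frac12\sum_{x'}\eta(x_0\to x')d_Y(f(x_0),f(x'))^p$. $p$-uniformly convex: there is $c_Y>0$ with $d_Y(x,\gamma(t))^p\le(1-t)d_Y(x,y)^p+t\,d_Y(x,z)^p-c_Y^pt(1-t)d_Y(y,z)^p$ for all $x,y,z$,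 constant-speed geodesics $\gamma$ from $y$ to $z$, $t\in[0,1]$. Poincaré modulus $\Lambda^{(p)}_Z(\sigma)$: least $\Lambda$ with $\sum_{u,v}\nu(u)\nu(v)d_Z(f(u),f(v))^p\le\Lambda^p\sum_{u,v}\nu(u)\mu(u\to v)d_Z(f(u),f(v))^p$ for every finite reversible ergodic Markov chain $(V,\mu,\nu)$ of spectral gap $\ge\sigma$ and every $f:V\to Z$; $\Lambda^{(p)}_Y(\sigma,N)=\sup\{\Lambda^{(p)}_{Y'}(\sigma):Y'\subseteq Y,|Y'|\le N\}$. Property $(\mathrm P_p)$ of $\alpha$: there exist constants $a,b,K>0$ such that for every metric space $Y$ and isometric action of $\Gamma_\alpha$ on $Y$ there are arbitrarily large $N_i$ such that for every $f\in B(X,Y)$ there is an integer $m\in[a\log N_i,b\log N_i]$ with $\mathcal E^{(p)}_{\mu_X^{jm}}(f)\le K(\Lambda^{(p)}_Y(\sigma,N_i))^p\mathcal E^{(p)}_{\mu_X^j}(f)$. *)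

theory Defs
  imports "HOL-Analysis.Analysis"
begin

section \<open>The free group \<Gamma> on S, |S| = 2k\<close>

text \<open>A letter (a,b) with a < k is the generator s_a (b = False) or its inverse (b = True).
  S = gens k has exactly 2k elements; group elements are freely reduced words.\<close>

type_synonym letter = "nat \<times> bool"

definition gens :: "nat \<Rightarrow> letter set" where
  "gens k = {(a, b). a < k}"

definition inv_letter :: "letter \<Rightarrow> letter" where
  "inv_letter l = (fst l, \<not> snd l)"

definition inv_word :: "letter list \<Rightarrow> letter list" where
  "inv_word w = rev (map inv_letter w)"

fun reduce :: "letter list \<Rightarrow> letter list" where
  "reduce [] = []"
| "reduce (x # xs) =
     (case reduce xs of [] \<Rightarrow> [x]
      | y # ys \<Rightarrow> (if y = inv_letter x then ys else x # y # ys))"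

definition free_group :: "nat \<Rightarrow> letter list set" where
  "free_group k = reduce ` lists (gens k)"

definition fg_mult :: "letter list \<Rightarrow> letter list \<Rightarrow> letter list" where
  "fg_mult v w = reduce (v @ w)"

text \<open>n-th convolution power of the uniform measure on S (simple random walk on
  X = Cay(\<Gamma>,S) started at the identity): mu_pow k n x = \<mu>_X^n(x_0 \<rightarrow> x).\<close>
definition mu_pow :: "nat \<Rightarrow> nat \<Rightarrow> letter list \<Rightarrow> real" where
  "mu_pow k n x =
     real (card {w \<in> lists (gens k). length w = n \<and> reduce w = x}) / (2 * real k) ^ n"

section \<open>Actions\<close>

definition letter_act :: "'y set \<Rightarrow> (nat \<Rightarrow> 'y \<Rightarrow> 'y) \<Rightarrow> letter \<Rightarrow> 'y \<Rightarrow> 'y" where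
  "letter_act Y \<rho> l = (if snd l then inv_into Y (\<rho> (fst l)) else \<rho> (fst l))"

definition word_act :: "'y set \<Rightarrow> (nat \<Rightarrow> 'y \<Rightarrow> 'y) \<Rightarrow> letter list \<Rightarrow> 'y \<Rightarrow> 'y" where
  "word_act Y \<rho> w = foldr (\<lambda>l f. letter_act Y \<rho> l \<circ> f) w id"

section \<open>Graphs G_i (vertex set {..<n}, adjacency e)\<close>

definition simple_graph :: "nat \<Rightarrow> (nat \<Rightarrow> nat \<Rightarrow> bool) \<Rightarrow> bool" where
  "simple_graph n e \<longleftrightarrow> (\<forall>u v. e u v \<longrightarrow> u < n \<and> v < n \<and> u \<noteq> v \<and> e v u)"

definition degree :: "nat \<Rightarrow> (nat \<Rightarrow> nat \<Rightarrow> bool) \<Rightarrow> nat \<Rightarrow> nat" where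
  "degree n e u = card {v. v < n \<and> e u v}"

definition graph_connected :: "nat \<Rightarrow> (nat \<Rightarrow> nat \<Rightarrow> bool) \<Rightarrow> bool" where
  "graph_connected n e \<longleftrightarrow> (\<forall>u<n. \<forall>v<n. (u, v) \<in> {(x, y). e x y}\<^sup>*)"

definition bipartite :: "nat \<Rightarrow> (nat \<Rightarrow> nat \<Rightarrow> bool) \<Rightarrow> bool" where
  "bipartite n e \<longleftrightarrow> (\<exists>col :: nat \<Rightarrow> bool. \<forall>u<n. \<forall>v<n. e u v \<longrightarrow> col u \<noteq> col v)"

text \<open>A cycle is given by its closed vertex list [v_0,...,v_{l-1},v_0] of length l+1, l \<ge> 3,
  with v_0..v_{l-1} distinct and consecutive vertices adjacent.\<close>
definition is_cycle :: "nat \<Rightarrow> (nat \<Rightarrow> nat \<Rightarrow> bool) \<Rightarrow> nat list \<Rightarrow> bool" where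
  "is_cycle n e vs \<longleftrightarrow> 4 \<le> length vs \<and> hd vs = last vs \<and> distinct (butlast vs)
     \<and> (\<forall>t. Suc t < length vs \<longrightarrow> e (vs ! t) (vs ! Suc t))"

definition cycle_length :: "nat list \<Rightarrow> nat" where
  "cycle_length vs = length vs - 1"

text \<open>Transition matrix of the simple random walk on a graph.\<close>
definition srw :: "nat \<Rightarrow> (nat \<Rightarrow> nat \<Rightarrow> bool) \<Rightarrow> nat \<Rightarrow> nat \<Rightarrow> real" where
  "srw n e u v = (if e u v then 1 / real (degree n e u) else 0)"

section \<open>Markov chains and spectral gap\<close>

definition markov_chain :: "nat set \<Rightarrow> (nat \<Rightarrow> nat \<Rightarrow> real) \<Rightarrow> (nat \<Rightarrow> real) \<Rightarrow> bool" where
  "markov_chain V \<mu> \<nu> \<longleftrightarrow> finite V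
     \<and> (\<forall>u\<in>V. \<forall>v\<in>V. 0 \<le> \<mu> u v) \<and> (\<forall>u\<in>V. (\<Sum>v\<in>V. \<mu> u v) = 1)
     \<and> (\<forall>u\<in>V. 0 < \<nu> u) \<and> (\<Sum>u\<in>V. \<nu> u) = 1
     \<and> (\<forall>u\<in>V. \<forall>v\<in>V. \<nu> u * \<mu> u v = \<nu> v * \<mu> v u)
     \<and> (\<forall>u\<in>V. \<forall>v\<in>V. (u, v) \<in> {(x, y). x \<in> V \<and> y \<in> V \<and> 0 < \<mu> x y}\<^sup>*)"

definition eigenvalues :: "nat set \<Rightarrow> (nat \<Rightarrow> nat \<Rightarrow> real) \<Rightarrow> real set" where
  "eigenvalues V \<mu> = {ev. \<exists>f. (\<exists>u\<in>V. f u \<noteq> 0) \<and> (\<forall>u\<in>V. (\<Sum>v\<in>V. \<mu> u v * f v) = ev * f u)}"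

text \<open>Spectral gap 1 - \<lambda>_2, \<lambda>_2 the largest eigenvalue other than the (simple, for an
  irreducible chain) eigenvalue 1.\<close>
definition spectral_gap :: "nat set \<Rightarrow> (nat \<Rightarrow> nat \<Rightarrow> real) \<Rightarrow> real" where
  "spectral_gap V \<mu> = 1 - Max (eigenvalues V \<mu> - {1})"

section \<open>Poincare moduli\<close>

definition poincare_modulus :: "real \<Rightarrow> 'z set \<Rightarrow> ('z \<Rightarrow> 'z \<Rightarrow> real) \<Rightarrow> real \<Rightarrow> ereal" where
  "poincare_modulus p Z dZ \<sigma> = Inf {ereal \<Lambda> | \<Lambda>. 0 \<le> \<Lambda> \<and>
     (\<forall>V \<mu> \<nu> f. markov_chain V \<mu> \<nu> \<and> \<sigma> \<le> spectral_gap V \<mu> \<and> f ` V \<subseteq> Z \<longrightarrow>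
        (\<Sum>u\<in>V. \<Sum>v\<in>V. \<nu> u * \<nu> v * dZ (f u) (f v) powr p)
          \<le> \<Lambda> powr p * (\<Sum>u\<in>V. \<Sum>v\<in>V. \<nu> u * \<mu> u v * dZ (f u) (f v) powr p))}"

definition poincare_modulus_N :: "real \<Rightarrow> 'z set \<Rightarrow> ('z \<Rightarrow> 'z \<Rightarrow> real) \<Rightarrow> real \<Rightarrow> nat \<Rightarrow> ereal" where
  "poincare_modulus_N p Y dY \<sigma> N =
     Sup {poincare_modulus p Y' dY \<sigma> | Y'. Y' \<subseteq> Y \<and> finite Y' \<and> card Y' \<le> N}"

section \<open>Geodesic, uniformly convex spaces\<close>

definition geodesic :: "'y set \<Rightarrow> ('y \<Rightarrow> 'y \<Rightarrow> real) \<Rightarrow> (real \<Rightarrow> 'y) \<Rightarrow> 'y \<Rightarrow> 'y \<Rightarrow> bool" where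
  "geodesic Y d \<gamma> y z \<longleftrightarrow> \<gamma> 0 = y \<and> \<gamma> 1 = z \<and> (\<forall>t\<in>{0..1}. \<gamma> t \<in> Y)
     \<and> (\<forall>s\<in>{0..1}. \<forall>t\<in>{0..1}. d (\<gamma> s) (\<gamma> t) = \<bar>s - t\<bar> * d y z)"

definition geodesic_space :: "'y set \<Rightarrow> ('y \<Rightarrow> 'y \<Rightarrow> real) \<Rightarrow> bool" where
  "geodesic_space Y d \<longleftrightarrow> (\<forall>y\<in>Y. \<forall>z\<in>Y. \<exists>\<gamma>. geodesic Y d \<gamma> y z)"

definition p_uniformly_convex :: "real \<Rightarrow> 'y set \<Rightarrow> ('y \<Rightarrow> 'y \<Rightarrow> real) \<Rightarrow> bool" where
  "p_uniformly_convex p Y d \<longleftrightarrow> (\<exists>c>0. \<forall>x\<in>Y. \<forall>y\<in>Y. \<forall>z\<in>Y. \<forall>\<gamma>. geodesic Y d \<gamma> y z \<longrightarrow>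
     (\<forall>t\<in>{0..1}. d x (\<gamma> t) powr p \<le> (1 - t) * d x y powr p + t * d x z powr p
                     - c powr p * t * (1 - t) * d y z powr p))"

section \<open>Labelings, \<Gamma>_\<alpha>-actions, equivariant maps, energies, property (P_p)\<close>

text \<open>G = disjoint union of the G_i: vertices (i,u), u < N i, adjacency E i.\<close>
definition labeling :: "nat \<Rightarrow> nat \<Rightarrow> (nat \<Rightarrow> nat) \<Rightarrow> (nat \<Rightarrow> nat \<Rightarrow> nat \<Rightarrow> bool)
    \<Rightarrow> (nat \<Rightarrow> nat \<Rightarrow> nat \<Rightarrow> letter list) \<Rightarrow> bool" where
  "labeling k j N E \<alpha> \<longleftrightarrow> (\<forall>i u v. E i u v \<longrightarrow>
     length (\<alpha> i u v) = j \<and> set (\<alpha> i u v) \<subseteq> gens k \<and> \<alpha> i v u = inv_word (\<alpha> i u v))"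

definition cycle_word :: "(nat \<Rightarrow> nat \<Rightarrow> nat \<Rightarrow> letter list) \<Rightarrow> nat \<Rightarrow> nat list \<Rightarrow> letter list" where
  "cycle_word \<alpha> i vs = concat (map (\<lambda>t. \<alpha> i (vs ! t) (vs ! Suc t)) [0..<length vs - 1])"

text \<open>An isometric action of \<Gamma>_\<alpha> on Y: generators act by bijective isometries and all
  relators (label products along cycles of G) act trivially.\<close>
definition alpha_action :: "nat \<Rightarrow> (nat \<Rightarrow> nat) \<Rightarrow> (nat \<Rightarrow> nat \<Rightarrow> nat \<Rightarrow> bool)
    \<Rightarrow> (nat \<Rightarrow> nat \<Rightarrow> nat \<Rightarrow> letter list) \<Rightarrow> 'y set \<Rightarrow> ('y \<Rightarrow> 'y \<Rightarrow> real)
    \<Rightarrow> (nat \<Rightarrow> 'y \<Rightarrow> 'y) \<Rightarrow> bool" where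
  "alpha_action k N E \<alpha> Y d \<rho> \<longleftrightarrow>
     (\<forall>a<k. bij_betw (\<rho> a) Y Y \<and> (\<forall>x\<in>Y. \<forall>y\<in>Y. d (\<rho> a x) (\<rho> a y) = d x y))
     \<and> (\<forall>i vs. is_cycle (N i) (E i) vs \<longrightarrow> (\<forall>y\<in>Y. word_act Y \<rho> (cycle_word \<alpha> i vs) y = y))"

text \<open>B(X,Y): \<Gamma>-equivariant maps from X = Cay(\<Gamma>,S) (vertex set \<Gamma>) to Y.\<close>
definition equivariant :: "nat \<Rightarrow> 'y set \<Rightarrow> (nat \<Rightarrow> 'y \<Rightarrow> 'y) \<Rightarrow> (letter list \<Rightarrow> 'y) \<Rightarrow> bool" where
  "equivariant k Y \<rho> f \<longleftrightarrow> (\<forall>x\<in>free_group k. f x \<in> Y)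
     \<and> (\<forall>g\<in>free_group k. \<forall>x\<in>free_group k. f (fg_mult g x) = word_act Y \<rho> g (f x))"

text \<open>E^{(p)}_\<eta>(f), x_0 = identity = [], \<eta> x' = \<eta>(x_0 \<rightarrow> x') finitely supported.\<close>
definition energy :: "nat \<Rightarrow> real \<Rightarrow> ('y \<Rightarrow> 'y \<Rightarrow> real) \<Rightarrow> (letter list \<Rightarrow> real)
    \<Rightarrow> (letter list \<Rightarrow> 'y) \<Rightarrow> real" where
  "energy k p d \<eta> f =
     1 / 2 * (\<Sum>x'\<in>{x' \<in> free_group k. \<eta> x' \<noteq> 0}. \<eta> x' * d (f []) (f x') powr p)"

text \<open>Property (P_p); metric spaces are quantified over carriers in the type 'y.\<close>
definition prop_P :: "real \<Rightarrow> real \<Rightarrow> nat \<Rightarrow> nat \<Rightarrow> (nat \<Rightarrow> nat) \<Rightarrow> (nat \<Rightarrow> nat \<Rightarrow> nat \<Rightarrow> bool)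
    \<Rightarrow> (nat \<Rightarrow> nat \<Rightarrow> nat \<Rightarrow> letter list) \<Rightarrow> 'y itself \<Rightarrow> bool" where
  "prop_P p \<sigma> k j N E \<alpha> (_ :: 'y itself) \<longleftrightarrow>
     (\<exists>a>0. \<exists>b>0. \<exists>K>0. \<forall>(Y :: 'y set) d \<rho>.
        Metric_space Y d \<and> alpha_action k N E \<alpha> Y d \<rho> \<longrightarrow>
        (\<forall>M. \<exists>i. M \<le> N i \<and>
           (\<forall>f. equivariant k Y \<rho> f \<longrightarrow>
              (\<exists>m::nat. a * ln (real (N i)) \<le> real m \<and> real m \<le> b * ln (real (N i)) \<and>
                 (\<forall>L. poincare_modulus_N p Y d \<sigma> (N i) = ereal L \<longrightarrow>
                    energy k p d (mu_pow k (j * m)) f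
                      \<le> K * L powr p * energy k p d (mu_pow k j) f)))))"

end

theory Submission
  imports "HOL-Probability.Hoeffding" Defs
begin

text \<open>
  An equivariant map on the free group is determined by its value \<open>y\<close> at the identity. Let \<open>P\<close> be
  the averaging operator over words of length \<open>j\<close>, and let \<open>V\<^sub>n(z)\<close> be the mean of \<open>d(z, \<cdot>)\<^sup>p\<close> over
  the \<open>n\<close>-step \<open>P\<close>-walk started at \<open>y\<close>, so that \<open>V\<^sub>n(y)\<close> is twice the energy of \<open>y\<close> at time \<open>j n\<close>.
  If \<open>b\<close> minimises \<open>V\<^sub>m\<close>, uniform convexity gives \<open>V\<^sub>m(b) + \<kappa> d(b,z)\<^sup>p \<le> V\<^sub>m(z)\<close> for all \<open>z\<close>. Averaging over
  \<open>z = w b\<close> and using the symmetry of the walk bounds the energy of \<open>b\<close> by a multiple of \<open>V\<^sub>m\<^sub>+\<^sub>1(b) - V\<^sub>m(b)\<close>.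

  Since \<open>j\<close> is even, some word of length \<open>j\<close> is trivial, hence \<open>P = \<delta> I + (1 - \<delta>) Q\<close> with \<open>\<delta> > 0\<close>, and
  \<open>P\<^sup>m\<close>, \<open>P\<^sup>m\<^sup>+\<^sup>1\<close> are binomial averages of the powers of \<open>Q\<close>. The ratio of their weights is at most
  \<open>1 + O(sqrt (ln m / m))\<close> outside a Hoeffding tail of polynomially small mass, so the difference above is
  \<open>O(sqrt (ln m / m)) V\<^sub>m(y)\<close> up to a negligible term. With \<open>m\<close> of order \<open>ln N\<close>, property \<open>(P\<^sub>p)\<close> and the growth
  condition on the Poincare moduli make this at most half the energy of \<open>y\<close>. Iterating \<open>y \<mapsto> b\<close> converges
  to a point of energy zero.
\<close>

section \<open>Barycenters in uniformly convex spaces\<close>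

text \<open>\<open>\<kappa>\<close> stands for \<open>c_Y powr p\<close>, the only form in which the
  convexity constant occurs.\<close>

locale uniformly_convex_space = Metric_space Y d
  for Y :: "'y set" and d :: "'y \<Rightarrow> 'y \<Rightarrow> real" +
  fixes p \<kappa> :: real
  assumes p_gt_0: "0 < p" and \<kappa>_pos: "0 < \<kappa>"
    and complete: "mcomplete"
    and nonempty: "Y \<noteq> {}"
    and geodesics: "geodesic_space Y d"
    and convex: "\<lbrakk>x \<in> Y; y \<in> Y; z \<in> Y; geodesic Y d \<gamma> y z; t \<in> {0..1}\<rbrakk> \<Longrightarrow>
      d x (\<gamma> t) powr p \<le> (1 - t) * d x y powr p + t * d x z powr p
        - \<kappa> * t * (1 - t) * d y z powr p"
begin

section \<open>Continuous and uniformly convex functions on the space\<close>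

definition seq_continuous :: "('y \<Rightarrow> real) \<Rightarrow> bool" where
  "seq_continuous V \<longleftrightarrow> (\<forall>s x. range s \<subseteq> Y \<longrightarrow> x \<in> Y \<longrightarrow> (\<lambda>n. d (s n) x) \<longlonglongrightarrow> 0 \<longrightarrow>
     (\<lambda>n. V (s n)) \<longlonglongrightarrow> V x)"

text \<open>The constant \<open>\<kappa>\<close> is that of the functions
  \<open>d x _ powr p\<close>, so averages of these keep it unchanged.\<close>

definition uniformly_convex :: "('y \<Rightarrow> real) \<Rightarrow> bool" where
  "uniformly_convex V \<longleftrightarrow> (\<forall>y\<in>Y. \<forall>z\<in>Y. \<forall>\<gamma>. geodesic Y d \<gamma> y z \<longrightarrow> (\<forall>t\<in>{0..1}.
     V (\<gamma> t) \<le> (1 - t) * V y + t * V z - \<kappa> * t * (1 - t) * d y z powr p))"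

lemma uniformly_convexD:
  "\<lbrakk>uniformly_convex V; y \<in> Y; z \<in> Y; geodesic Y d \<gamma> y z; 0 \<le> t; t \<le> 1\<rbrakk> \<Longrightarrow>
    V (\<gamma> t) \<le> (1 - t) * V y + t * V z - \<kappa> * t * (1 - t) * d y z powr p"
  unfolding uniformly_convex_def by force

lemma MCauchy_limit:
  assumes "MCauchy s"
  obtains x where "x \<in> Y" "(\<lambda>n. d (s n) x) \<longlonglongrightarrow> 0"
  using assms complete unfolding mcomplete_def limitin_metric_dist_null by blast

lemma tendsto_dist:
  assumes "range s \<subseteq> Y" "x \<in> Y" "(\<lambda>n. d (s n) x) \<longlonglongrightarrow> 0"
    and "range s' \<subseteq> Y" "x' \<in> Y" "(\<lambda>n. d (s' n) x') \<longlonglongrightarrow> 0"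
  shows "(\<lambda>n. d (s n) (s' n)) \<longlonglongrightarrow> d x x'"
proof (rule Lim_transform_bound[where g = "\<lambda>n. d (s n) x + d (s' n) x'" and f = "\<lambda>n. d (s n) (s' n) - d x x'",
      THEN LIM_zero_cancel])
  have "norm (d (s n) (s' n) - d x x') \<le> norm (d (s n) x + d (s' n) x')" for n
  proof -
    have "s n \<in> Y" "s' n \<in> Y" using assms by auto
    then have "d (s n) (s' n) \<le> d (s n) x + d x x' + d x' (s' n)"
      "d x x' \<le> d x (s n) + d (s n) (s' n) + d (s' n) x'"
      using triangle[of "s n" x "s' n"] triangle[of x x' "s' n"] triangle[of x "s n" x']
        triangle[of "s n" "s' n" x'] assms by auto
    then show ?thesis
      using commute nonneg by (smt (verit) real_norm_def)
  qed
  then show "\<forall>\<^sub>F n in sequentially. norm (d (s n) (s' n) - d x x') \<le> norm (d (s n) x + d (s' n) x')"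
    by simp
  show "(\<lambda>n. d (s n) x + d (s' n) x') \<longlonglongrightarrow> 0"
    using tendsto_add[OF assms(3,6)] by simp
qed

text \<open>Two nonexpansive maps at once cover both uses: the distance to a given point (identity
  and a constant map) and the displacement \<open>d z (A w z)\<close>.\<close>

lemma seq_continuous_dist_powr:
  assumes "T ` Y \<subseteq> Y" "T' ` Y \<subseteq> Y"
    and "\<And>x y. x \<in> Y \<Longrightarrow> y \<in> Y \<Longrightarrow> d (T x) (T y) \<le> d x y"
    and "\<And>x y. x \<in> Y \<Longrightarrow> y \<in> Y \<Longrightarrow> d (T' x) (T' y) \<le> d x y"
  shows "seq_continuous (\<lambda>z. d (T z) (T' z) powr p)"
  unfolding seq_continuous_def
proof (intro allI impI)
  fix s x assume s: "range s \<subseteq> Y" "x \<in> Y" and lim: "(\<lambda>n. d (s n) x) \<longlonglongrightarrow> 0"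
  have sY: "s n \<in> Y" for n using s(1) by auto
  have "(\<lambda>n. d (T (s n)) (T x)) \<longlonglongrightarrow> 0"
    by (rule tendsto_sandwich[OF _ _ tendsto_const lim]) (simp_all add: assms(3) sY s(2))
  moreover have "(\<lambda>n. d (T' (s n)) (T' x)) \<longlonglongrightarrow> 0"
    by (rule tendsto_sandwich[OF _ _ tendsto_const lim]) (simp_all add: assms(4) sY s(2))
  ultimately have "(\<lambda>n. d (T (s n)) (T' (s n))) \<longlonglongrightarrow> d (T x) (T' x)"
    using s sY assms(1,2) by (intro tendsto_dist) (simp_all add: image_subset_iff)
  then show "(\<lambda>n. d (T (s n)) (T' (s n)) powr p) \<longlonglongrightarrow> d (T x) (T' x) powr p"
    by (rule tendsto_powr'[OF _ tendsto_const]) (simp add: p_gt_0)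
qed

lemma seq_continuous_average:
  assumes "\<And>w. w \<in> W \<Longrightarrow> seq_continuous (V w)"
  shows "seq_continuous (\<lambda>z. (\<Sum>w\<in>W. V w z) / real (card W))"
  unfolding seq_continuous_def divide_inverse
proof (intro allI impI tendsto_mult_right tendsto_sum)
  fix s x w assume "range s \<subseteq> Y" "x \<in> Y" "(\<lambda>n. d (s n) x) \<longlonglongrightarrow> 0" "w \<in> W"
  then show "(\<lambda>n. V w (s n)) \<longlonglongrightarrow> V w x"
    using assms unfolding seq_continuous_def by blast
qed

lemma uniformly_convex_average:
  assumes "\<And>w. w \<in> W \<Longrightarrow> uniformly_convex (V w)" "finite W" "W \<noteq> {}"
  shows "uniformly_convex (\<lambda>z. (\<Sum>w\<in>W. V w z) / real (card W))"
  unfolding uniformly_convex_def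
proof (intro ballI allI impI)
  fix y z \<gamma> and t :: real
  assume *: "y \<in> Y" "z \<in> Y" "geodesic Y d \<gamma> y z" "t \<in> {0..1}"
  have card: "0 < real (card W)" using assms by (simp add: card_gt_0_iff)
  have "(\<Sum>w\<in>W. V w (\<gamma> t)) \<le> (\<Sum>w\<in>W. (1 - t) * V w y + t * V w z - \<kappa> * t * (1 - t) * d y z powr p)"
    using assms(1) * unfolding uniformly_convex_def by (intro sum_mono) blast
  also have "\<dots> = (1 - t) * (\<Sum>w\<in>W. V w y) + t * (\<Sum>w\<in>W. V w z)
      - real (card W) * (\<kappa> * t * (1 - t) * d y z powr p)"
    by (simp add: sum.distrib sum_subtractf sum_distrib_left)
  finally show "(\<Sum>w\<in>W. V w (\<gamma> t)) / real (card W) \<le> (1 - t) * ((\<Sum>w\<in>W. V w y) / real (card W))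
      + t * ((\<Sum>w\<in>W. V w z) / real (card W)) - \<kappa> * t * (1 - t) * d y z powr p"
    using card by (simp add: field_simps)
qed

lemma dist_powr_seq_continuous_uniformly_convex:
  assumes "x \<in> Y"
  shows "seq_continuous (\<lambda>z. d z x powr p)" "uniformly_convex (\<lambda>z. d z x powr p)"
proof -
  show "seq_continuous (\<lambda>z. d z x powr p)"
    by (rule seq_continuous_dist_powr) (use assms in auto)
  show "uniformly_convex (\<lambda>z. d z x powr p)"
    unfolding uniformly_convex_def commute[of _ x] using convex[OF assms] by blast
qed

section \<open>Minimisers and contracting iterations\<close>

text \<open>Near-minimisers form a Cauchy sequence, since the midpoint of two distant ones would
  fall below the infimum. Moving from the limit \<open>b\<close> a short way towards
  \<open>y\<close> and letting the step shrink gives the quantitative bound.\<close>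

lemma barycenter_exists:
  assumes cont: "seq_continuous V" and conv: "uniformly_convex V"
    and pos: "\<And>y. y \<in> Y \<Longrightarrow> 0 \<le> V y"
  obtains b where "b \<in> Y" "\<And>y. y \<in> Y \<Longrightarrow> V b + \<kappa> * d b y powr p \<le> V y"
proof -
  define I where "I = Inf (V ` Y)"
  have bdd: "bdd_below (V ` Y)" using pos by (auto simp: bdd_below_def)
  have I_le: "I \<le> V y" if "y \<in> Y" for y
    unfolding I_def using that bdd by (auto intro: cInf_lower)
  have "\<exists>y\<in>Y. V y < I + e" if "e > 0" for e
    using cInf_lessD[of "V ` Y" "I + e"] nonempty that by (auto simp: I_def)
  then have "\<forall>n. \<exists>y\<in>Y. V y < I + inverse (real (Suc n))" by simp
  then obtain s where s: "\<And>n. s n \<in> Y" "\<And>n. V (s n) < I + inverse (real (Suc n))"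
    by metis
  have close: "d (s m) (s n) powr p \<le> 4 / \<kappa> * inverse (real (Suc k))" if "k \<le> m" "k \<le> n" for k m n
  proof -
    obtain \<gamma> where \<gamma>: "geodesic Y d \<gamma> (s m) (s n)"
      using geodesics s unfolding geodesic_space_def by blast
    then have "I \<le> V (\<gamma> (1/2))" unfolding geodesic_def by (intro I_le) auto
    \<comment> \<open>At \<open>t = 1/2\<close> convexity gains \<open>\<kappa> / 4\<close> times
      the powered distance, whence the factor 4.\<close>
    moreover have "V (\<gamma> (1/2)) \<le> (1 - 1/2) * V (s m) + 1/2 * V (s n)
        - \<kappa> * (1/2) * (1 - 1/2) * d (s m) (s n) powr p"
      by (rule uniformly_convexD[OF conv s(1) s(1) \<gamma>]) auto
    moreover have "inverse (real (Suc m)) \<le> inverse (real (Suc k))"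
      "inverse (real (Suc n)) \<le> inverse (real (Suc k))"
      using that by (auto intro!: le_imp_inverse_le)
    ultimately have "\<kappa> * d (s m) (s n) powr p \<le> 4 * inverse (real (Suc k))"
      using s(2)[of m] s(2)[of n] by argo
    then show ?thesis using \<kappa>_pos by (simp add: pos_le_divide_eq mult.commute del: of_nat_Suc)
  qed
  have "MCauchy s"
    unfolding MCauchy_def
  proof (intro conjI allI impI)
    show "range s \<subseteq> Y" using s by auto
    fix e :: real assume "e > 0"
    have "(\<lambda>k. 4 / \<kappa> * inverse (real (Suc k))) \<longlonglongrightarrow> 4 / \<kappa> * 0"
      by (intro tendsto_mult_left LIMSEQ_inverse_real_of_nat)
    then have "eventually (\<lambda>k. 4 / \<kappa> * inverse (real (Suc k)) < e powr p) sequentially"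
      using \<open>e > 0\<close> by (intro order_tendstoD) auto
    then obtain k where k: "4 / \<kappa> * inverse (real (Suc k)) < e powr p"
      by (auto simp: eventually_sequentially)
    show "\<exists>N. \<forall>n n'. N \<le> n \<longrightarrow> N \<le> n' \<longrightarrow> d (s n) (s n') < e"
    proof (intro exI allI impI)
      fix m n assume "k \<le> m" "k \<le> n"
      then have "d (s m) (s n) powr p < e powr p" using close[of k m n] k by linarith
      then show "d (s m) (s n) < e"
        using \<open>e > 0\<close> p_gt_0 powr_mono2[of p e "d (s m) (s n)"] by linarith
    qed
  qed
  then obtain b where b: "b \<in> Y" "(\<lambda>n. d (s n) b) \<longlonglongrightarrow> 0" by (rule MCauchy_limit)
  then have "(\<lambda>n. V (s n)) \<longlonglongrightarrow> V b"
    using cont s(1) unfolding seq_continuous_def by blast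
  moreover have "(\<lambda>n. I + inverse (real (Suc n))) \<longlonglongrightarrow> I + 0"
    by (intro tendsto_add tendsto_const LIMSEQ_inverse_real_of_nat)
  ultimately have "V b \<le> I + 0"
    by (rule LIMSEQ_le) (use s(2) less_imp_le in blast)
  then have Vb: "V b = I" using I_le[OF b(1)] by simp
  show ?thesis
  proof (rule that[OF b(1)])
    fix y assume y: "y \<in> Y"
    obtain \<gamma> where \<gamma>: "geodesic Y d \<gamma> b y"
      using geodesics b y unfolding geodesic_space_def by blast
    have "\<kappa> * d b y powr p \<le> V y - V b"
    \<comment> \<open>The point at time \<open>1 - z\<close> lies on the way from \<open>b\<close>
      to \<open>y\<close>; after division by \<open>1 - z\<close>, letting \<open>z\<close> tend to
      1 is the limit of short steps.\<close>
    proof (rule field_le_mult_one_interval)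
      fix z :: real assume z: "0 < z" "z < 1"
      then have "\<gamma> (1 - z) \<in> Y" using \<gamma> unfolding geodesic_def by auto
      moreover have "V (\<gamma> (1 - z)) \<le> (1 - (1 - z)) * V b + (1 - z) * V y
        - \<kappa> * (1 - z) * (1 - (1 - z)) * d b y powr p"
        using z by (intro uniformly_convexD[OF conv b(1) y \<gamma>]) auto
      ultimately have "(1 - z) * (z * (\<kappa> * d b y powr p)) \<le> (1 - z) * (V y - V b)"
        using I_le[of "\<gamma> (1 - z)"] Vb by (simp add: algebra_simps)
      then show "z * (\<kappa> * d b y powr p) \<le> V y - V b" using z by simp
    qed
    then show "V b + \<kappa> * d b y powr p \<le> V y" by simp
  qed
qed

text \<open>Halving \<open>e\<close> makes the step lengths decay geometrically with ratio
  \<open>(1/2) powr (1/p)\<close>, so the iterates converge, and continuity makes \<open>e\<close>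
  vanish at their limit.\<close>

lemma contracting_iteration_zero:
  assumes cont: "seq_continuous e" and pos: "\<And>y. y \<in> Y \<Longrightarrow> 0 \<le> e y"
    and step: "\<And>y. y \<in> Y \<Longrightarrow> \<exists>b\<in>Y. e b \<le> e y / 2 \<and> d y b powr p \<le> C * e y"
  obtains x where "x \<in> Y" "e x = 0"
proof -
  obtain T where T: "\<And>y. y \<in> Y \<Longrightarrow> T y \<in> Y" "\<And>y. y \<in> Y \<Longrightarrow> e (T y) \<le> e y / 2"
    "\<And>y. y \<in> Y \<Longrightarrow> d y (T y) powr p \<le> C * e y"
    using step by metis
  obtain y0 where y0: "y0 \<in> Y" using nonempty by auto
  define s where "s n = (T ^^ n) y0" for n
  have sY: "s n \<in> Y" for n unfolding s_def by (induction n) (auto simp: y0 T)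
  have s_Suc: "s (Suc n) = T (s n)" for n by (simp add: s_def)
  have e_s: "e (s n) \<le> e y0 * (1/2) ^ n" for n
  proof (induction n)
    case (Suc n)
    then show ?case using T(2)[OF sY[of n]] by (simp add: s_Suc)
  qed (simp add: s_def)
  \<comment> \<open>The absolute value is taken because no sign is assumed for
    \<open>C\<close>.\<close>
  define B where "B = \<bar>C\<bar> * e y0"
  define \<theta> :: real where "\<theta> = (1/2) powr (1/p)"
  have \<theta>: "0 < \<theta>" "\<theta> < 1"
    using p_gt_0 powr_less_mono2[of "1/p" "1/2" 1] by (auto simp: \<theta>_def)
  have B: "0 \<le> B" using pos[OF y0] by (simp add: B_def)
  have dist_s: "d (s n) (s (Suc n)) \<le> B powr (1/p) * \<theta> ^ n" for n
  proof -
    have "d (s n) (s (Suc n)) powr p \<le> \<bar>C\<bar> * e (s n)"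
      using T(3)[OF sY[of n]] mult_right_mono[OF abs_ge_self pos[OF sY[of n]], of C]
      by (simp add: s_Suc)
    also have "\<dots> \<le> B * (1/2) ^ n"
      using mult_left_mono[OF e_s[of n], of "\<bar>C\<bar>"] by (simp add: B_def mult.assoc)
    finally have "(d (s n) (s (Suc n)) powr p) powr (1/p) \<le> (B * (1/2) ^ n) powr (1/p)"
      using p_gt_0 by (intro powr_mono2) auto
    then show ?thesis
      using p_gt_0 B by (simp add: powr_powr powr_mult \<theta>_def powr_realpow[symmetric] mult.commute)
  qed
  \<comment> \<open>\<open>B'\<close> is the sum of the geometric series of step bounds; keeping
    both ends in \<open>tail\<close> makes its induction telescope.\<close>
  define B' where "B' = B powr (1/p) / (1 - \<theta>)"
  have B'nn: "0 \<le> B'" using \<theta> by (simp add: B'_def)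
  have B': "B powr (1/p) = B' * (1 - \<theta>)" using \<theta> by (simp add: B'_def)
  have tail: "d (s n) (s (n + m)) \<le> B' * \<theta> ^ n - B' * \<theta> ^ (n + m)" for n m
  proof (induction m)
    case 0
    then show ?case using sY by simp
  next
    case (Suc m)
    have "d (s n) (s (n + Suc m)) \<le> d (s n) (s (n + m)) + d (s (n + m)) (s (Suc (n + m)))"
      using triangle sY by simp
    also have "\<dots> \<le> B' * \<theta> ^ n - B' * \<theta> ^ (n + m) + B' * (1 - \<theta>) * \<theta> ^ (n + m)"
      using Suc dist_s[of "n + m"] by (simp add: B')
    finally show ?case by (simp add: algebra_simps)
  qed
  have "MCauchy s"
    unfolding MCauchy_def
  proof (intro conjI allI impI)
    show "range s \<subseteq> Y" using sY by auto
    fix \<epsilon> :: real assume "\<epsilon> > 0"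
    have "(\<lambda>n. B' * \<theta> ^ n) \<longlonglongrightarrow> B' * 0"
      using \<theta> by (intro tendsto_mult_left LIMSEQ_realpow_zero) auto
    then have "eventually (\<lambda>n. B' * \<theta> ^ n < \<epsilon>) sequentially"
      using \<open>\<epsilon> > 0\<close> by (intro order_tendstoD) auto
    then obtain N where N: "\<And>n. N \<le> n \<Longrightarrow> B' * \<theta> ^ n < \<epsilon>"
      by (auto simp: eventually_sequentially)
    have less: "d (s m) (s n) < \<epsilon>" if "N \<le> m" "m \<le> n" for m n
    proof -
      have "0 \<le> B' * \<theta> ^ n" using B'nn \<theta> by simp
      then show ?thesis using tail[of m "n - m"] N[of m] that by simp
    qed
    show "\<exists>N. \<forall>n n'. N \<le> n \<longrightarrow> N \<le> n' \<longrightarrow> d (s n) (s n') < \<epsilon>"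
      using less commute by (metis nle_le)
  qed
  then obtain x where x: "x \<in> Y" "(\<lambda>n. d (s n) x) \<longlonglongrightarrow> 0" by (rule MCauchy_limit)
  then have "(\<lambda>n. e (s n)) \<longlonglongrightarrow> e x"
    using cont sY unfolding seq_continuous_def by blast
  moreover have "(\<lambda>n. e y0 * (1/2) ^ n) \<longlonglongrightarrow> e y0 * 0"
    by (intro tendsto_mult_left LIMSEQ_realpow_zero) auto
  ultimately have "e x \<le> e y0 * 0" using e_s by (intro LIMSEQ_le) auto
  then show ?thesis using that x(1) pos[OF x(1)] by simp
qed

end

section \<open>Lazy random walks and binomial averages\<close>

text \<open>With steps uniform in \<open>W\<close> this is the operator \<open>P\<close> on
  functions; with \<open>W - {w0}\<close> it is \<open>Q\<close>.\<close>

definition average :: "'w set \<Rightarrow> ('w \<Rightarrow> 'y \<Rightarrow> 'y) \<Rightarrow> ('y \<Rightarrow> real) \<Rightarrow> 'y \<Rightarrow> real" where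
  "average W A h y = (\<Sum>w\<in>W. h (A w y)) / real (card W)"

text \<open>For \<open>q\<close> in \<open>[0, 1]\<close>, the probability that a binomial variable
  with parameters \<open>n\<close> and \<open>q\<close> equals \<open>i\<close>.\<close>

definition binom_weight :: "real \<Rightarrow> nat \<Rightarrow> nat \<Rightarrow> real" where
  "binom_weight q n i = real (n choose i) * q ^ i * (1 - q) ^ (n - i)"

section \<open>Binomial weights for successive numbers of trials\<close>

lemma binom_weight_nonneg: "0 \<le> q \<Longrightarrow> q \<le> 1 \<Longrightarrow> 0 \<le> binom_weight q n i"
  by (simp add: binom_weight_def)

lemma binom_weight_eq_0: "n < i \<Longrightarrow> binom_weight q n i = 0"
  by (simp add: binom_weight_def)

lemma binom_weight_Suc_0: "binom_weight q (Suc n) 0 = (1 - q) * binom_weight q n 0"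
  by (simp add: binom_weight_def)

lemma binom_weight_Suc_Suc:
  "binom_weight q (Suc n) (Suc i) = (1 - q) * binom_weight q n (Suc i) + q * binom_weight q n i"
proof (cases "Suc i \<le> n")
  case True
  then have "n - i = Suc (n - Suc i)" by simp
  then show ?thesis by (simp add: binom_weight_def algebra_simps)
next
  case False
  then show ?thesis by (simp add: binom_weight_def binomial_eq_0)
qed

text \<open>The ratio of the weights for \<open>Suc n\<close> and \<open>n\<close> trials, cleared
  of its denominator.\<close>

lemma binom_weight_Suc_ratio:
  assumes "i \<le> n"
  shows "binom_weight q (Suc n) i * real (Suc n - i) = binom_weight q n i * (real (Suc n) * (1 - q))"
proof -
  have "real (Suc n choose i) * real (Suc n - i) = real (Suc n) * real (n choose i)"
    using binomial_absorb_comp[of "Suc n" i] unfolding of_nat_mult[symmetric]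
    by (simp only: diff_Suc_1 mult.commute)
  moreover have "Suc n - i = Suc (n - i)" using assms by simp
  ultimately show ?thesis by (simp add: binom_weight_def del: binomial_Suc_Suc)
qed

text \<open>Hoeffding's inequality for the upper tail, which is the side on which the ratio of
  successive weights becomes large.\<close>

lemma binom_weight_tail:
  assumes q: "0 \<le> q" "q \<le> 1" and "0 < n" "0 \<le> t"
  shows "(\<Sum>i\<in>{i. i \<le> n \<and> real n * q + t < real i}. binom_weight q n i) \<le> exp (- 2 * t\<^sup>2 / real n)"
proof -
  interpret binomial_distribution n q by unfold_locales (use q in auto)
  have "(\<Sum>i\<in>{i. i \<le> n \<and> real n * q + t < real i}. binom_weight q n i)
      = measure_pmf.prob (binomial_pmf n q) {i. i \<le> n \<and> real n * q + t < real i}"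
    using q by (subst measure_measure_pmf_finite) (auto simp: binom_weight_def)
  also have "\<dots> \<le> measure_pmf.prob (binomial_pmf n q) {x. real x \<ge> real n * q + t}"
    by (intro measure_pmf.finite_measure_mono) auto
  also have "\<dots> \<le> exp (- 2 * t\<^sup>2 / real n)"
    using prob_ge[of t] assms by simp
  finally show ?thesis .
qed

text \<open>Up to the cut \<open>Suc m * q + t\<close> the weights for \<open>Suc m\<close> trials
  are at most \<open>r\<close> times those for \<open>m\<close>; above it \<open>g\<close> is
  replaced by \<open>B\<close> and the mass by the tail bound.\<close>

lemma binom_average_Suc_le:
  fixes g :: "nat \<Rightarrow> real"
  assumes q: "0 \<le> q" "q < 1" and t: "0 \<le> t" "t \<le> (1 - q) * real (Suc m) / 2"
    and g: "\<And>i. 0 \<le> g i" "\<And>i. i \<le> Suc m \<Longrightarrow> g i \<le> B"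
  shows "(\<Sum>i\<le>Suc m. binom_weight q (Suc m) i * g i)
    \<le> (1 + 2 * t / ((1 - q) * real (Suc m))) * (\<Sum>i\<le>m. binom_weight q m i * g i)
      + exp (- 2 * t\<^sup>2 / real (Suc m)) * B"
proof -
  define n where "n = Suc m"
  define r where "r = 1 + 2 * t / ((1 - q) * real n)"
  define H where "H = {i. i \<le> n \<and> real n * q + t < real i}"
  have pos: "0 < (1 - q) * real n" using q by (simp add: n_def)
  have t2: "2 * t \<le> (1 - q) * real n" using t by (simp add: n_def)
  have r: "0 \<le> r" using t(1) pos by (simp add: r_def)
  have low: "binom_weight q n i \<le> r * binom_weight q m i" if "i \<le> n" "i \<notin> H" for i
  proof -
    have i: "real i \<le> real n * q + t" using that by (auto simp: H_def)
    have gap: "(1 - q) * real n - t \<le> real n - real i" using i by (simp add: algebra_simps)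
    \<comment> \<open>The bound on \<open>t\<close> puts \<open>i = Suc m\<close>, where the weight
      for \<open>m\<close> vanishes, into the tail \<open>H\<close>.\<close>
    then have "0 < real n - real i" using t2 pos by linarith
    then have im: "i \<le> m" by (simp add: n_def)
    \<comment> \<open>For \<open>s = t / ((1 - q) * n) \<le> 1/2\<close> one has
      \<open>1 \<le> (1 + 2 * s) * (1 - s)\<close>, whence the factor 2 in \<open>r\<close>.\<close>
    have "0 \<le> t * ((1 - q) * real n - 2 * t)" using t t2 by simp
    then have "(1 - q) * real n \<le> r * ((1 - q) * real n - t)"
      using pos q by (simp add: r_def field_simps n_def)
    also have "\<dots> \<le> r * (real n - real i)" using gap r by (rule mult_left_mono)
    finally have *: "(1 - q) * real n \<le> r * (real n - real i)" .
    have "binom_weight q n i * (real n - real i) = binom_weight q m i * (real n * (1 - q))"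
      using binom_weight_Suc_ratio[OF im, of q] im by (simp add: n_def of_nat_diff)
    also have "\<dots> \<le> binom_weight q m i * (r * (real n - real i))"
      using * q by (intro mult_left_mono binom_weight_nonneg) (auto simp: mult.commute)
    finally have "binom_weight q n i * (real n - real i) \<le> (r * binom_weight q m i) * (real n - real i)"
      by (simp add: algebra_simps)
    then show ?thesis using \<open>0 < real n - real i\<close> by simp
  qed
  have B: "0 \<le> B" using g(1)[of 0] g(2)[of 0] by simp
  have H: "H \<subseteq> {..n}" "finite H" by (auto simp: H_def intro: finite_subset[of _ "{..n}"])
  have bw: "0 \<le> binom_weight q k i" for k i using q by (simp add: binom_weight_nonneg)
  have "(\<Sum>i\<le>n. binom_weight q n i * g i)
      = (\<Sum>i\<in>{..n} - H. binom_weight q n i * g i) + (\<Sum>i\<in>H. binom_weight q n i * g i)"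
    using H by (intro sum.subset_diff) auto
  also have "(\<Sum>i\<in>{..n} - H. binom_weight q n i * g i) \<le> (\<Sum>i\<in>{..n} - H. r * binom_weight q m i * g i)"
    using low g by (intro sum_mono mult_right_mono) auto
  also have "\<dots> \<le> (\<Sum>i\<le>n. r * binom_weight q m i * g i)"
    using r bw g by (intro sum_mono2) auto
  also have "\<dots> = r * (\<Sum>i\<le>m. binom_weight q m i * g i)"
    by (simp add: n_def binom_weight_eq_0 sum_distrib_left mult.assoc)
  also have "(\<Sum>i\<in>H. binom_weight q n i * g i) \<le> (\<Sum>i\<in>H. binom_weight q n i * B)"
    using bw g by (intro sum_mono mult_left_mono) (auto simp: H_def n_def)
  also have "\<dots> = (\<Sum>i\<in>H. binom_weight q n i) * B" by (simp add: sum_distrib_right)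
  also have "\<dots> \<le> exp (- 2 * t\<^sup>2 / real n) * B"
    unfolding H_def using q t B by (intro mult_right_mono binom_weight_tail) (auto simp: n_def)
  finally show ?thesis by (simp add: r_def n_def)
qed

section \<open>Lazy symmetric walks by isometries\<close>

text \<open>The trivial step \<open>w0\<close> makes the walk lazy, and \<open>iv\<close> makes it
  symmetric; \<open>act_adjoint\<close> phrases the symmetry through distances.
  \<open>2 \<le> card W\<close> keeps \<open>W - {w0}\<close> nonempty.\<close>

locale isometric_walk = uniformly_convex_space Y d p \<kappa>
  for Y :: "'y set" and d :: "'y \<Rightarrow> 'y \<Rightarrow> real" and p \<kappa> :: real +
  fixes W :: "'w set" and A :: "'w \<Rightarrow> 'y \<Rightarrow> 'y" and iv :: "'w \<Rightarrow> 'w" and w0 :: 'w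
  assumes finite_W: "finite W" and w0_in: "w0 \<in> W" and card_W: "2 \<le> card W"
    and act_closed: "\<lbrakk>w \<in> W; x \<in> Y\<rbrakk> \<Longrightarrow> A w x \<in> Y"
    and act_isometry: "\<lbrakk>w \<in> W; x \<in> Y; y \<in> Y\<rbrakk> \<Longrightarrow> d (A w x) (A w y) = d x y"
    and iv_closed: "w \<in> W \<Longrightarrow> iv w \<in> W"
    and iv_iv: "w \<in> W \<Longrightarrow> iv (iv w) = w"
    and act_adjoint: "\<lbrakk>w \<in> W; x \<in> Y; y \<in> Y\<rbrakk> \<Longrightarrow> d (A w x) y = d x (A (iv w) y)"
    and act_w0: "x \<in> Y \<Longrightarrow> A w0 x = x"
begin

text \<open>This is \<open>V_n(z)\<close>; the starting point \<open>y\<close> remains an argument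
  because the recursion moves it.\<close>

definition potential :: "nat \<Rightarrow> 'y \<Rightarrow> 'y \<Rightarrow> real" where
  "potential n y z = (average W A ^^ n) (\<lambda>u. d z u powr p) y"

lemma potential_0: "potential 0 y z = d z y powr p"
  by (simp add: potential_def)

lemma potential_Suc: "potential (Suc n) y z = (\<Sum>w\<in>W. potential n (A w y) z) / real (card W)"
  by (simp add: potential_def average_def)

lemma W_nonempty: "W \<noteq> {}"
  using w0_in by auto

lemma potential_seq_continuous_uniformly_convex:
  assumes "y \<in> Y"
  shows "seq_continuous (potential n y) \<and> uniformly_convex (potential n y)"
  using assms
proof (induction n arbitrary: y)
  case 0
  then show ?case using dist_powr_seq_continuous_uniformly_convex[of y] by (simp add: potential_0[abs_def])
next
  case (Suc n)
  then show ?case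
    unfolding potential_Suc[abs_def]
    using W_nonempty finite_W act_closed
    by (intro conjI seq_continuous_average uniformly_convex_average) auto
qed

lemma potential_nonneg: "0 \<le> potential n y z"
  by (induction n arbitrary: y) (auto simp: potential_0 potential_Suc intro!: sum_nonneg divide_nonneg_nonneg)

text \<open>Inverting the step, where \<open>iv\<close> permutes \<open>W\<close>, moves it to the
  other argument of \<open>d\<close>. This settles \<open>n = 0\<close>, and interchanging sums
  gives the induction.\<close>

lemma potential_average:
  assumes "y \<in> Y" "z \<in> Y"
  shows "(\<Sum>w\<in>W. potential n y (A w z)) / real (card W) = potential (Suc n) y z"
  using assms(1)
proof (induction n arbitrary: y)
  case 0
  have "(\<Sum>w\<in>W. d (A w z) y powr p) = (\<Sum>w\<in>W. d z (A (iv w) y) powr p)"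
    using act_adjoint 0 assms by (intro sum.cong) auto
  also have "\<dots> = (\<Sum>w\<in>W. d z (A w y) powr p)"
    by (rule sum.reindex_bij_witness[of _ iv iv]) (auto simp: iv_closed iv_iv)
  finally show ?case by (simp add: potential_0 potential_Suc)
next
  case (Suc n)
  have "(\<Sum>w\<in>W. potential (Suc n) y (A w z)) / real (card W)
      = (\<Sum>v\<in>W. (\<Sum>w\<in>W. potential n (A v y) (A w z)) / real (card W)) / real (card W)"
    unfolding potential_Suc by (subst sum_divide_distrib[symmetric], subst sum.swap) (simp add: sum_divide_distrib)
  also have "\<dots> = (\<Sum>v\<in>W. potential (Suc n) (A v y) z) / real (card W)"
    using Suc act_closed by simp
  finally show ?case by (simp add: potential_Suc[of "Suc n"])
qed

abbreviation "lazy_prob \<equiv> 1 / real (card W)"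

text \<open>Splitting off \<open>w0\<close> gives \<open>P = \<delta> I + (1 - \<delta>) Q\<close>
  with \<open>\<delta> = lazy_prob\<close>, at points of \<open>Y\<close>, where \<open>w0\<close>
  acts trivially.\<close>

lemma average_lazy:
  assumes "y \<in> Y"
  shows "average W A h y = lazy_prob * h y + (1 - lazy_prob) * average (W - {w0}) A h y"
proof -
  have "real (card W) = 1 + real (card (W - {w0}))" "0 < real (card (W - {w0}))"
    using card_W w0_in finite_W by (auto simp: card_Diff_singleton of_nat_diff)
  moreover have "(\<Sum>w\<in>W. h (A w y)) = h y + (\<Sum>w\<in>W - {w0}. h (A w y))"
    using finite_W w0_in assms by (simp add: sum.remove act_w0)
  moreover have "(a + b) / (1 + c) = 1 / (1 + c) * a + (1 - 1 / (1 + c)) * (b / c)" if "0 < c"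
    for a b c :: real
  proof -
    have "1 - 1 / (1 + c) = c / (1 + c)" using that by (simp add: field_simps)
    then show ?thesis using that by (simp add: add_divide_distrib)
  qed
  ultimately show ?thesis by (simp add: average_def)
qed

text \<open>The binomial theorem for the commuting operators \<open>I\<close> and \<open>Q\<close>,
  proved pointwise on \<open>Y\<close> by the Pascal recursion of the weights.\<close>

lemma average_pow_binomial:
  assumes "y \<in> Y"
  shows "(average W A ^^ n) h y
    = (\<Sum>i\<le>n. binom_weight (1 - lazy_prob) n i * (average (W - {w0}) A ^^ i) h y)"
  using assms
proof (induction n arbitrary: y)
  case 0
  then show ?case by (simp add: binom_weight_def)
next
  case (Suc n)
  define q where "q = 1 - lazy_prob"
  define \<beta> where "\<beta> = binom_weight q"
  let ?Q = "average (W - {w0}) A"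
  let ?g = "\<lambda>i. (?Q ^^ i) h y"
  \<comment> \<open>The induction hypothesis is applied at the points \<open>A w y\<close>, which
    stay in \<open>Y\<close>.\<close>
  have "?Q ((average W A ^^ n) h) y = ?Q (\<lambda>u. \<Sum>i\<le>n. \<beta> n i * (?Q ^^ i) h u) y"
    unfolding average_def[of "W - {w0}" A _ y] using Suc act_closed by (simp add: q_def \<beta>_def)
  also have "\<dots> = (\<Sum>i\<le>n. \<beta> n i * ?g (Suc i))"
    unfolding funpow.simps o_def average_def[of "W - {w0}" A _ y]
    by (subst sum.swap) (simp add: sum_distrib_left sum_divide_distrib)
  finally have Q: "?Q ((average W A ^^ n) h) y = (\<Sum>i\<le>n. \<beta> n i * ?g (Suc i))" .
  have "(average W A ^^ Suc n) h y = (1 - q) * (\<Sum>i\<le>n. \<beta> n i * ?g i) + q * (\<Sum>i\<le>n. \<beta> n i * ?g (Suc i))"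
    using Suc by (simp add: average_lazy Q q_def \<beta>_def del: funpow.simps(2))
      (simp add: average_lazy Q[unfolded q_def \<beta>_def])
  \<comment> \<open>The added term \<open>i = Suc n\<close> has weight 0; splitting off
    \<open>i = 0\<close> then aligns the two sums.\<close>
  also have "(\<Sum>i\<le>n. \<beta> n i * ?g i) = (\<Sum>i\<le>Suc n. \<beta> n i * ?g i)"
    by (simp add: \<beta>_def binom_weight_eq_0)
  also have "\<dots> = \<beta> n 0 * ?g 0 + (\<Sum>i\<le>n. \<beta> n (Suc i) * ?g (Suc i))"
    by (rule sum.atMost_Suc_shift)
  also have "(1 - q) * (\<beta> n 0 * ?g 0 + (\<Sum>i\<le>n. \<beta> n (Suc i) * ?g (Suc i)))
      + q * (\<Sum>i\<le>n. \<beta> n i * ?g (Suc i))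
      = \<beta> (Suc n) 0 * ?g 0 + (\<Sum>i\<le>n. \<beta> (Suc n) (Suc i) * ?g (Suc i))"
    unfolding \<beta>_def binom_weight_Suc_0 binom_weight_Suc_Suc
    by (simp add: algebra_simps sum.distrib[symmetric] sum_distrib_left del: funpow.simps)
  also have "\<dots> = (\<Sum>i\<le>Suc n. \<beta> (Suc n) i * ?g i)"
    by (rule sum.atMost_Suc_shift[symmetric])
  finally show ?case by (simp add: q_def \<beta>_def del: funpow.simps)
qed

text \<open>Since \<open>d y (A w u) \<le> d y (A w y) + d y u\<close>, each step adds at most
  \<open>R\<close> to the distance from \<open>y\<close>, so \<open>n\<close> steps stay within
  \<open>n * R\<close>.\<close>

lemma average_pow_le:
  assumes "y \<in> Y" "V \<subseteq> W" "V \<noteq> {}" "\<And>w. w \<in> V \<Longrightarrow> d y (A w y) \<le> R"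
    and "\<And>u. u \<in> Y \<Longrightarrow> d y u \<le> real n * R \<Longrightarrow> h u \<le> B"
  shows "(average V A ^^ n) h y \<le> B"
  using assms(5)
proof (induction n arbitrary: h)
  case 0
  then show ?case using assms(1) by simp
next
  case (Suc n)
  have "(average V A ^^ n) (average V A h) y \<le> B"
  proof (rule Suc.IH)
    fix u assume u: "u \<in> Y" "d y u \<le> real n * R"
    have "h (A w u) \<le> B" if "w \<in> V" for w
    proof (rule Suc.prems)
      have w: "w \<in> W" using that assms by auto
      then show "A w u \<in> Y" using u act_closed by blast
      have "d y (A w u) \<le> d y (A w y) + d (A w y) (A w u)"
        using w u assms(1) act_closed by (intro triangle) auto
      then show "d y (A w u) \<le> real (Suc n) * R"
        using assms(1,4) u w that act_isometry by (fastforce simp: algebra_simps)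
    qed
    then have "(\<Sum>w\<in>V. h (A w u)) \<le> (\<Sum>w\<in>V. B)" by (intro sum_mono)
    then show "average V A h u \<le> B"
      using assms(2,3) finite_W finite_subset[of V W] by (simp add: average_def field_simps card_gt_0_iff)
  qed
  then show ?case by (simp add: funpow_swap1)
qed

lemma average_pow_nonneg:
  assumes "\<And>u. 0 \<le> h u"
  shows "0 \<le> (average V A ^^ n) h y"
  using assms by (induction n arbitrary: y) (auto simp: average_def intro!: sum_nonneg divide_nonneg_nonneg)

text \<open>The binomial comparison is applied to the powers of \<open>Q\<close>, with
  \<open>1 - q = lazy_prob\<close>; on the tail the integrand is bounded through the reach of
  \<open>Suc m\<close> steps.\<close>

lemma potential_Suc_le:
  assumes y: "y \<in> Y" and z: "z \<in> Y" and R: "\<And>w. w \<in> W \<Longrightarrow> d y (A w y) \<le> R"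
    and t: "0 \<le> t" "t \<le> lazy_prob * real (Suc m) / 2"
  shows "potential (Suc m) y z \<le> (1 + 2 * t / (lazy_prob * real (Suc m))) * potential m y z
      + exp (- 2 * t\<^sup>2 / real (Suc m)) * (d z y + real (Suc m) * R) powr p"
proof -
  let ?g = "\<lambda>i. (average (W - {w0}) A ^^ i) (\<lambda>u. d z u powr p) y"
  have card: "0 < lazy_prob" "lazy_prob \<le> 1" using card_W by auto
  have "W - {w0} \<noteq> {}"
    using card_W w0_in finite_W by (metis One_nat_def card.empty card_Suc_Diff1 not_less_eq_eq numeral_2_eq_2 order_refl)
  have R0: "0 \<le> R" using R[OF w0_in] nonneg order_trans by blast
  have "?g i \<le> (d z y + real (Suc m) * R) powr p" if "i \<le> Suc m" for i
  proof (rule average_pow_le[OF y _ \<open>W - {w0} \<noteq> {}\<close>])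
    fix u assume u: "u \<in> Y" "d y u \<le> real i * R"
    have "real i * R \<le> real (Suc m) * R" using that R0 by (intro mult_right_mono) auto
    then have "d z u \<le> d z y + real (Suc m) * R" using triangle[OF z y u(1)] u(2) by linarith
    then show "d z u powr p \<le> (d z y + real (Suc m) * R) powr p"
      using p_gt_0 by (intro powr_mono2) auto
  qed (use R in auto)
  then show ?thesis
    using binom_average_Suc_le[of "1 - lazy_prob" t m ?g "(d z y + real (Suc m) * R) powr p"] t card
    by (simp add: potential_def average_pow_binomial[OF y] average_pow_nonneg del: funpow.simps sum.atMost_Suc of_nat_Suc)
qed

section \<open>One-step energy and its bound at a barycenter\<close>

text \<open>In the application this is twice the energy for \<open>mu_pow k j\<close> of the orbit
  map of \<open>y\<close>.\<close>

definition energy1 :: "'y \<Rightarrow> real" where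
  "energy1 y = potential 1 y y"

lemma energy1_eq: "energy1 y = (\<Sum>w\<in>W. d y (A w y) powr p) / real (card W)"
  by (simp add: energy1_def potential_Suc potential_0)

lemma energy1_nonneg: "0 \<le> energy1 y"
  unfolding energy1_def by (rule potential_nonneg)

lemma seq_continuous_energy1: "seq_continuous energy1"
  unfolding energy1_eq[abs_def]
  by (intro seq_continuous_average seq_continuous_dist_powr) (auto simp: act_closed act_isometry)

text \<open>One summand is at most the whole sum. This bounds the reach of the walk and, at energy
  zero, shows that every step fixes \<open>y\<close>.\<close>

lemma displacement_le_energy1:
  assumes "w \<in> W"
  shows "d y (A w y) \<le> (real (card W) * energy1 y) powr (1 / p)"
proof -
  have "d y (A w y) powr p \<le> (\<Sum>w\<in>W. d y (A w y) powr p)"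
    using finite_W assms by (intro member_le_sum) auto
  then have "d y (A w y) powr p \<le> real (card W) * energy1 y"
    using card_W by (simp add: energy1_eq)
  then have "(d y (A w y) powr p) powr (1 / p) \<le> (real (card W) * energy1 y) powr (1 / p)"
    using p_gt_0 by (intro powr_mono2) auto
  then show ?thesis using p_gt_0 by (simp add: powr_powr)
qed

lemma powr_add_le: "(x + y) powr p \<le> 2 powr p * (x powr p + y powr p)" if "0 \<le> x" "0 \<le> y" for x y :: real
proof -
  have "(x + y) powr p \<le> (2 * max x y) powr p" using that p_gt_0 by (intro powr_mono2) auto
  also have "\<dots> = 2 powr p * max x y powr p" using that by (simp add: powr_mult)
  also have "max x y powr p \<le> x powr p + y powr p" by (simp add: max_def)
  finally show ?thesis by simp
qed

text \<open>\<open>b\<close> is the barycenter of the distribution of the \<open>m\<close>-step walk started at \<open>y\<close>.\<close>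
lemma barycenter_step:
  assumes y: "y \<in> Y" and t: "0 \<le> t" "t \<le> lazy_prob * real (Suc m) / 2"
  obtains b where "b \<in> Y" "\<kappa> * d y b powr p \<le> potential m y y"
    "\<kappa> * energy1 b \<le> 2 * t / (lazy_prob * real (Suc m)) * potential m y y
      + exp (- 2 * t\<^sup>2 / real (Suc m)) * 2 powr p
        * (potential m y y / \<kappa> + real (Suc m) powr p * real (card W) * energy1 y)"
proof -
  let ?V = "potential m y"
  obtain b where b: "b \<in> Y" and min: "\<And>z. z \<in> Y \<Longrightarrow> ?V b + \<kappa> * d b z powr p \<le> ?V z"
    using barycenter_exists[of ?V] potential_seq_continuous_uniformly_convex[OF y] potential_nonneg by metis
  have by_le: "\<kappa> * d y b powr p \<le> ?V y"
    using min[OF y] potential_nonneg[of m y b] by (simp add: commute)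
  have Vb: "?V b \<le> ?V y" using min[OF y] \<kappa>_pos by (smt (verit) mult_nonneg_nonneg powr_ge_zero)
  have card: "0 < real (card W)" using card_W by simp
  \<comment> \<open>Minimality is used at the points \<open>A w b\<close>; by
    \<open>potential_average\<close> the sum over \<open>w\<close> becomes one further step of the
    walk.\<close>
  have "real (card W) * (\<kappa> * energy1 b) = (\<Sum>w\<in>W. \<kappa> * d b (A w b) powr p)"
    using card by (simp add: energy1_eq sum_distrib_left[symmetric])
  also have "\<dots> \<le> (\<Sum>w\<in>W. ?V (A w b) - ?V b)"
    using min b act_closed by (intro sum_mono) (smt (verit))
  also have "\<dots> = real (card W) * (potential (Suc m) y b - ?V b)"
    using card by (simp add: potential_average[OF y b, symmetric] sum_subtractf field_simps)
  finally have 1: "\<kappa> * energy1 b \<le> potential (Suc m) y b - ?V b" using card by simp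
  define n where "n = real (Suc m)"
  define R where "R = (real (card W) * energy1 y) powr (1 / p)"
  have Rp: "R powr p = real (card W) * energy1 y"
    using p_gt_0 card energy1_nonneg[of y] by (simp add: R_def powr_powr)
  have 2: "potential (Suc m) y b \<le> (1 + 2 * t / (lazy_prob * n)) * ?V b
      + exp (- 2 * t\<^sup>2 / n) * (d b y + n * R) powr p"
    unfolding n_def using displacement_le_energy1 t y b by (intro potential_Suc_le) (auto simp: R_def)
  have 3: "2 * t / (lazy_prob * n) * ?V b \<le> 2 * t / (lazy_prob * n) * ?V y"
    using Vb t(1) card by (intro mult_left_mono) (auto simp: n_def)
  have "(d b y + n * R) powr p \<le> 2 powr p * (d b y powr p + (n * R) powr p)"
    by (intro powr_add_le) (auto simp: n_def R_def)
  also have "(n * R) powr p = n powr p * real (card W) * energy1 y"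
    using Rp by (simp add: powr_mult n_def mult.assoc)
  also have "d b y powr p \<le> ?V y / \<kappa>"
    using by_le \<kappa>_pos by (simp add: commute field_simps)
  finally have "(d b y + n * R) powr p \<le> 2 powr p * (?V y / \<kappa> + n powr p * real (card W) * energy1 y)"
    by simp
  then have 4: "exp (- 2 * t\<^sup>2 / n) * (d b y + n * R) powr p
      \<le> exp (- 2 * t\<^sup>2 / n) * (2 powr p * (?V y / \<kappa> + n powr p * real (card W) * energy1 y))"
    by (intro mult_left_mono) auto
  have "\<kappa> * energy1 b \<le> 2 * t / (lazy_prob * n) * ?V y
      + exp (- 2 * t\<^sup>2 / n) * (2 powr p * (?V y / \<kappa> + n powr p * real (card W) * energy1 y))"
    using 1 2 3 4 by (simp add: algebra_simps)
  then show ?thesis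
    using that[OF b by_le] by (simp add: n_def mult.assoc)
qed

end

section \<open>Energy contraction\<close>

lemma sqrt_ln_over_nat_tendsto_0: "(\<lambda>n. sqrt (ln (real n) / real n)) \<longlonglongrightarrow> 0"
proof -
  have "(\<lambda>n. ln (real n) / real n) \<longlonglongrightarrow> 0"
    by (rule filterlim_compose[OF ln_x_over_x_tendsto_0 filterlim_real_sequentially])
  then have "(\<lambda>n. sqrt (ln (real n) / real n)) \<longlonglongrightarrow> sqrt 0" by (rule tendsto_real_sqrt)
  then show ?thesis by simp
qed

lemma sqrt_lnln_over_ln_tendsto_0: "(\<lambda>n. sqrt (ln (ln (real n)) / ln (real n))) \<longlonglongrightarrow> 0"
proof -
  have "(\<lambda>n. ln (ln (real n)) / ln (real n)) \<longlonglongrightarrow> 0"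
    by (rule filterlim_compose[OF ln_x_over_x_tendsto_0
          filterlim_compose[OF ln_at_top filterlim_real_sequentially]])
  then have "(\<lambda>n. sqrt (ln (ln (real n)) / ln (real n))) \<longlonglongrightarrow> sqrt 0" by (rule tendsto_real_sqrt)
  then show ?thesis by simp
qed

text \<open>Used with \<open>X = ln N\<close> and \<open>n = Suc m\<close>, to pass from the scale
  of \<open>m\<close> to that of \<open>ln N\<close>: here \<open>n \<le> X * X\<close>, hence
  \<open>ln n \<le> 2 * ln X\<close>.\<close>

lemma sqrt_ln_over_self_le:
  fixes a b X n :: real
  assumes "0 < a" "0 < b" "b + 1 \<le> X" "1 \<le> a * X" "a * X \<le> n" "n \<le> b * X + 1"
  shows "sqrt (ln n / n) \<le> sqrt (2 / a) * sqrt (ln X / X)"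
proof -
  have X: "1 < X" using assms by simp
  have n: "1 \<le> n" using assms by simp
  have "(b + 1) * X \<le> X * X" using assms X by (intro mult_right_mono) auto
  then have "n \<le> X * X" using assms X by (simp add: algebra_simps)
  then have "ln n \<le> ln (X * X)" using n by simp
  then have "ln n \<le> 2 * ln X" using X by (simp add: ln_mult)
  then have "ln n / n \<le> 2 * ln X / (a * X)"
    using assms n X by (intro frac_le) auto
  also have "\<dots> = 2 / a * (ln X / X)" by simp
  finally have "sqrt (ln n / n) \<le> sqrt (2 / a * (ln X / X))" by simp
  then show ?thesis by (simp only: real_sqrt_mult)
qed

section \<open>Halving the energy\<close>

context isometric_walk
begin

text \<open>A suitable \<open>t\<close> in \<open>barycenter_step\<close> makes the first term of
  order \<open>sqrt (ln n / n)\<close> while the exponential still beats \<open>n powr p\<close>.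
  The thresholds depend neither on \<open>y\<close> nor on \<open>\<Lambda>\<close>.\<close>

lemma energy1_contraction:
  obtains \<epsilon> n0 where "0 < \<epsilon>"
    "\<And>m \<Lambda> y. \<lbrakk>n0 \<le> m; 0 \<le> \<Lambda>; \<Lambda> * sqrt (ln (real (Suc m)) / real (Suc m)) \<le> \<epsilon>; y \<in> Y;
       potential m y y \<le> \<Lambda> * energy1 y\<rbrakk>
     \<Longrightarrow> \<exists>b\<in>Y. energy1 b \<le> energy1 y / 2 \<and> d y b powr p \<le> \<Lambda> / \<kappa> * energy1 y"
proof -
  define w where "w = real (card W)"
  \<comment> \<open>The summands come from the first term, where \<open>1 / lazy_prob = w\<close>,
    and from the tail term with \<open>potential m y y / \<kappa>\<close>.\<close>
  define C where "C = 2 * sqrt (p + 1) * w + 2 powr p / \<kappa>"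
  have w: "0 < w" using card_W by (simp add: w_def)
  have C: "0 < C" using w p_gt_0 \<kappa>_pos by (simp add: C_def add_pos_pos)
  \<comment> \<open>Three demands on large \<open>n\<close>: \<open>t\<close> is admissible, the
    tail term with \<open>energy1 y\<close> costs at most \<open>\<kappa> / 4\<close>, and
    \<open>1 \<le> ln n\<close>.\<close>
  have "eventually (\<lambda>n. sqrt (ln (real n) / real n) < 1 / (2 * w * sqrt (p + 1))) sequentially"
    using sqrt_ln_over_nat_tendsto_0 w p_gt_0 by (intro order_tendstoD) auto
  moreover have "(\<lambda>n. 2 powr p * w * inverse (real n)) \<longlonglongrightarrow> 2 powr p * w * 0"
    by (intro tendsto_mult_left lim_inverse_n)
  then have "eventually (\<lambda>n. 2 powr p * w * inverse (real n) < \<kappa> / 4) sequentially"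
    using \<kappa>_pos by (intro order_tendstoD) auto
  moreover have "eventually (\<lambda>n. 3 \<le> n) sequentially" by (rule eventually_ge_at_top)
  ultimately have "eventually (\<lambda>n. sqrt (ln (real n) / real n) < 1 / (2 * w * sqrt (p + 1))
      \<and> 2 powr p * w * inverse (real n) < \<kappa> / 4 \<and> 3 \<le> n) sequentially"
    by eventually_elim auto
  then obtain n0 where n0: "\<And>n. n0 \<le> n \<Longrightarrow> sqrt (ln (real n) / real n) < 1 / (2 * w * sqrt (p + 1))
      \<and> 2 powr p * w * inverse (real n) < \<kappa> / 4 \<and> 3 \<le> n"
    by (auto simp: eventually_sequentially)
  show thesis
  proof (rule that[of "\<kappa> / (4 * C)" n0])
    show "0 < \<kappa> / (4 * C)" using C \<kappa>_pos by simp
    fix m \<Lambda> y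
    assume m: "n0 \<le> m" and \<Lambda>: "0 \<le> \<Lambda>"
      and small: "\<Lambda> * sqrt (ln (real (Suc m)) / real (Suc m)) \<le> \<kappa> / (4 * C)"
      and y: "y \<in> Y" and pot: "potential m y y \<le> \<Lambda> * energy1 y"
    define n where "n = real (Suc m)"
    define x where "x = sqrt (ln n / n)"
    have n: "3 \<le> n" and x_less: "x < 1 / (2 * w * sqrt (p + 1))" and n_big: "2 powr p * w * inverse n < \<kappa> / 4"
      using n0[of "Suc m"] m by (auto simp: n_def x_def)
    have "exp 1 \<le> n" using n exp_le by linarith
    then have ln_n: "1 \<le> ln n" using n by (simp add: ln_ge_iff)
    have x0: "0 \<le> x" using ln_n n by (simp add: x_def)
    have x2: "x\<^sup>2 = ln n / n" using ln_n n by (simp add: x_def)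
    \<comment> \<open>Chosen so that \<open>exp (- 2 * t\<^sup>2 / n)\<close> is
      \<open>n powr (- (2 * (p + 1)))\<close>, which absorbs \<open>n powr p\<close> and leaves at
      most \<open>inverse n\<close>.\<close>
    define t where "t = sqrt (p + 1) * n * x"
    have t0: "0 \<le> t" using p_gt_0 n x0 by (simp add: t_def)
    have "w * sqrt (p + 1) * x \<le> 1 / 2"
      using x_less w p_gt_0 by (simp add: field_simps)
    then have "w * t \<le> n / 2"
      using n mult_right_mono[of "w * sqrt (p + 1) * x" "1/2" n] by (simp add: t_def algebra_simps)
    then have t_le: "t \<le> lazy_prob * real (Suc m) / 2"
      unfolding w_def[symmetric] n_def[symmetric] using w by (simp add: field_simps)
    have t2: "- 2 * t\<^sup>2 / n = - (2 * (p + 1)) * ln n"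
      using p_gt_0 n by (simp add: t_def power_mult_distrib x2 power2_eq_square[of n]) (simp add: algebra_simps)
    then have ex: "exp (- 2 * t\<^sup>2 / n) = n powr (- (2 * (p + 1)))"
      using n by (simp add: powr_def)
    have inv_le: "inverse n \<le> x"
    proof -
      have "(inverse n)\<^sup>2 \<le> x\<^sup>2"
        unfolding x2 using n ln_n mult_mono[of 1 n 1 "ln n"] by (simp add: power2_eq_square field_simps)
      then show ?thesis using x0 by (rule power2_le_imp_le)
    qed
    have ex1: "exp (- 2 * t\<^sup>2 / n) \<le> x"
    proof -
      have "n powr (- (2 * (p + 1))) \<le> n powr (- 1)" using n p_gt_0 by (intro powr_mono) auto
      then show ?thesis unfolding ex using inv_le n by (simp add: powr_minus)
    qed
    have ex2: "exp (- 2 * t\<^sup>2 / n) * n powr p \<le> inverse n"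
    proof -
      have "exp (- 2 * t\<^sup>2 / n) * n powr p = n powr (- (2 * (p + 1)) + p)"
        unfolding ex by (simp only: powr_add)
      also have "\<dots> \<le> n powr (- 1)" using n p_gt_0 by (intro powr_mono) auto
      finally show ?thesis using n by (simp add: powr_minus)
    qed
    obtain b where b: "b \<in> Y" "\<kappa> * d y b powr p \<le> potential m y y"
      and e: "\<kappa> * energy1 b \<le> 2 * t / (lazy_prob * n) * potential m y y
      + exp (- 2 * t\<^sup>2 / n) * 2 powr p
        * (potential m y y / \<kappa> + n powr p * w * energy1 y)"
      using barycenter_step[OF y t0 t_le] by (metis n_def w_def)
    note e
    also have "2 * t / (lazy_prob * n) = 2 * sqrt (p + 1) * w * x"
      using n w by (simp add: t_def w_def[symmetric])
    also have "2 * sqrt (p + 1) * w * x * potential m y y \<le> 2 * sqrt (p + 1) * w * x * (\<Lambda> * energy1 y)"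
      using pot p_gt_0 w x0 by (intro mult_left_mono) auto
    also have "exp (- 2 * t\<^sup>2 / n) * 2 powr p * (potential m y y / \<kappa> + n powr p * w * energy1 y)
       = exp (- 2 * t\<^sup>2 / n) * (2 powr p * (potential m y y / \<kappa>))
        + (exp (- 2 * t\<^sup>2 / n) * n powr p) * (2 powr p * w * energy1 y)"
      by (simp add: algebra_simps)
    also have "exp (- 2 * t\<^sup>2 / n) * (2 powr p * (potential m y y / \<kappa>))
        \<le> x * (2 powr p * (\<Lambda> * energy1 y / \<kappa>))"
      using ex1 x0 pot \<kappa>_pos potential_nonneg[of m y y] by (intro mult_mono divide_right_mono) auto
    also have "(exp (- 2 * t\<^sup>2 / n) * n powr p) * (2 powr p * w * energy1 y)
        \<le> inverse n * (2 powr p * w * energy1 y)"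
      using ex2 w energy1_nonneg[of y] by (intro mult_right_mono) auto
    also have "2 * sqrt (p + 1) * w * x * (\<Lambda> * energy1 y)
        + (x * (2 powr p * (\<Lambda> * energy1 y / \<kappa>)) + inverse n * (2 powr p * w * energy1 y))
        = (C * (\<Lambda> * x) + 2 powr p * w * inverse n) * energy1 y"
      by (simp add: C_def algebra_simps)
    also have "\<dots> \<le> (\<kappa> / 4 + \<kappa> / 4) * energy1 y"
    proof (intro mult_right_mono add_mono energy1_nonneg)
      show "C * (\<Lambda> * x) \<le> \<kappa> / 4"
        using small C by (simp add: x_def n_def field_simps)
    qed (use n_big in auto)
    finally have "\<kappa> * energy1 b \<le> \<kappa> * (energy1 y / 2)" by simp
    then have "energy1 b \<le> energy1 y / 2" using \<kappa>_pos by simp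
    moreover have "d y b powr p \<le> \<Lambda> / \<kappa> * energy1 y"
      using b(2) pot \<kappa>_pos by (simp add: field_simps)
    ultimately show "\<exists>b\<in>Y. energy1 b \<le> energy1 y / 2 \<and> d y b powr p \<le> \<Lambda> / \<kappa> * energy1 y"
      using b(1) by blast
  qed
qed

text \<open>\<open>H\<close> condenses property \<open>(P_p)\<close> and the growth condition. There
  \<open>N\<close> and \<open>\<Lambda>\<close> serve all \<open>y\<close> while \<open>m\<close>
  may depend on \<open>y\<close>, so the constants stay the same along the iteration.\<close>

lemma energy1_zero_exists:
  assumes ab: "0 < a" "0 < b" and K: "0 < K"
    and H: "\<And>\<epsilon> M. 0 < \<epsilon> \<Longrightarrow> \<exists>N \<Lambda>. M \<le> N \<and> 0 \<le> \<Lambda> \<and>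
      \<Lambda> * sqrt (ln (ln (real N)) / ln (real N)) \<le> \<epsilon> \<and>
      (\<forall>y\<in>Y. \<exists>m::nat. a * ln (real N) \<le> real m \<and> real m \<le> b * ln (real N) \<and>
         potential m y y \<le> K * \<Lambda> * energy1 y)"
  obtains x where "x \<in> Y" "energy1 x = 0"
proof -
  obtain \<epsilon> n0 where \<epsilon>: "0 < \<epsilon>"
    and contr: "\<And>m \<Lambda> y. \<lbrakk>n0 \<le> m; 0 \<le> \<Lambda>; \<Lambda> * sqrt (ln (real (Suc m)) / real (Suc m)) \<le> \<epsilon>; y \<in> Y;
       potential m y y \<le> \<Lambda> * energy1 y\<rbrakk>
     \<Longrightarrow> \<exists>b\<in>Y. energy1 b \<le> energy1 y / 2 \<and> d y b powr p \<le> \<Lambda> / \<kappa> * energy1 y"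
    using energy1_contraction by blast
  \<comment> \<open>The entries provide, in turn, \<open>b + 1 \<le> X\<close> for the comparison of
    logarithms, \<open>1 \<le> a * X\<close>, and \<open>n0 \<le> m\<close>.\<close>
  define X0 where "X0 = max (b + 1) (max (1 / a) (real n0 / a))"
  have "eventually (\<lambda>N. X0 \<le> ln (real N)) sequentially"
    using filterlim_compose[OF ln_at_top filterlim_real_sequentially] by (simp add: filterlim_at_top)
  then obtain M where M: "\<And>N. M \<le> N \<Longrightarrow> X0 \<le> ln (real N)"
    by (auto simp: eventually_sequentially)
  have c: "0 < sqrt (2 / a) * K" using ab K by simp
  \<comment> \<open>The divisor compensates \<open>K\<close> and the loss in passing from
    \<open>m\<close> to \<open>ln N\<close>.\<close>
  obtain N \<Lambda> where N: "M \<le> N" and \<Lambda>: "0 \<le> \<Lambda>"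
    and small: "\<Lambda> * sqrt (ln (ln (real N)) / ln (real N)) \<le> \<epsilon> / (sqrt (2 / a) * K)"
    and m: "\<And>y. y \<in> Y \<Longrightarrow> \<exists>m::nat. a * ln (real N) \<le> real m \<and> real m \<le> b * ln (real N) \<and>
         potential m y y \<le> K * \<Lambda> * energy1 y"
    using H[of "\<epsilon> / (sqrt (2 / a) * K)" M] \<epsilon> c by auto
  define X where "X = ln (real N)"
  have "X0 \<le> X" using M[OF N] by (simp add: X_def)
  then have X: "b + 1 \<le> X" "1 \<le> a * X" "real n0 \<le> a * X"
    using ab by (auto simp: X0_def field_simps)
  have "\<exists>b\<in>Y. energy1 b \<le> energy1 y / 2 \<and> d y b powr p \<le> K * \<Lambda> / \<kappa> * energy1 y" if y: "y \<in> Y" for y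
  proof -
    obtain m where m: "a * X \<le> real m" "real m \<le> b * X" "potential m y y \<le> K * \<Lambda> * energy1 y"
      using m[OF y] unfolding X_def by blast
    have "sqrt (ln (real (Suc m)) / real (Suc m)) \<le> sqrt (2 / a) * sqrt (ln X / X)"
      using X m ab by (intro sqrt_ln_over_self_le[of a b]) auto
    then have "K * \<Lambda> * sqrt (ln (real (Suc m)) / real (Suc m)) \<le> K * \<Lambda> * (sqrt (2 / a) * sqrt (ln X / X))"
      using K \<Lambda> by (intro mult_left_mono) auto
    also have "\<dots> = (sqrt (2 / a) * K) * (\<Lambda> * sqrt (ln X / X))" by simp
    also have "\<dots> \<le> (sqrt (2 / a) * K) * (\<epsilon> / (sqrt (2 / a) * K))"
      using small c unfolding X_def by (intro mult_left_mono) auto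
    also have "\<dots> = \<epsilon>" using ab K by simp
    finally show ?thesis
      using m X K \<Lambda> y by (intro contr) auto
  qed
  then show thesis
    using contracting_iteration_zero[OF seq_continuous_energy1 energy1_nonneg] that by metis
qed

end

section \<open>Poincare moduli\<close>

lemma poincare_modulus_nonneg: "0 \<le> poincare_modulus p Z dZ \<sigma>"
  unfolding poincare_modulus_def by (intro Inf_greatest) auto

lemma poincare_modulus_mono:
  assumes "Z' \<subseteq> Z"
  shows "poincare_modulus p Z' dZ \<sigma> \<le> poincare_modulus p Z dZ \<sigma>"
  unfolding poincare_modulus_def
proof (rule Inf_superset_mono, rule Collect_mono, rule impI, elim exE conjE, intro exI conjI allI impI)
  fix x \<Lambda> V \<mu> \<nu> and f :: "nat \<Rightarrow> 'a"
  assume "x = ereal \<Lambda>" "0 \<le> \<Lambda>"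
  then show "x = ereal \<Lambda>" "0 \<le> \<Lambda>" .
  assume "\<forall>V \<mu> \<nu> f. markov_chain V \<mu> \<nu> \<and> \<sigma> \<le> spectral_gap V \<mu> \<and> f ` V \<subseteq> Z \<longrightarrow>
        (\<Sum>u\<in>V. \<Sum>v\<in>V. \<nu> u * \<nu> v * dZ (f u) (f v) powr p)
          \<le> \<Lambda> powr p * (\<Sum>u\<in>V. \<Sum>v\<in>V. \<nu> u * \<mu> u v * dZ (f u) (f v) powr p)"
    "markov_chain V \<mu> \<nu> \<and> \<sigma> \<le> spectral_gap V \<mu> \<and> f ` V \<subseteq> Z'"
  then show "(\<Sum>u\<in>V. \<Sum>v\<in>V. \<nu> u * \<nu> v * dZ (f u) (f v) powr p)
          \<le> \<Lambda> powr p * (\<Sum>u\<in>V. \<Sum>v\<in>V. \<nu> u * \<mu> u v * dZ (f u) (f v) powr p)"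
    using assms by (meson order_trans)
qed

text \<open>The empty subset is admissible, so the supremum is not over an empty family, where it
  would be \<open>-\<infinity>\<close>.\<close>

lemma poincare_modulus_N_nonneg: "0 \<le> poincare_modulus_N p Y dY \<sigma> n"
  unfolding poincare_modulus_N_def
  by (rule Sup_upper2[of "poincare_modulus p {} dY \<sigma>"]) (auto simp: poincare_modulus_nonneg intro!: exI[of _ "{}"])

lemma poincare_modulus_N_le: "poincare_modulus_N p Y dY \<sigma> n \<le> poincare_modulus p Y dY \<sigma>"
  unfolding poincare_modulus_N_def by (rule Sup_least) (auto intro: poincare_modulus_mono)

text \<open>Both alternatives lead to one estimate. A finite modulus bounds every \<open>L\<close>,
  and the square root tends to 0; in the other case raising to the power \<open>p\<close> turns the
  exponent \<open>1 / (2 * p)\<close> into a square root.\<close>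

lemma poincare_modulus_N_growth:
  assumes p: "0 < p" and \<epsilon>: "0 < \<epsilon>"
    and growth: "poincare_modulus p Y dY \<sigma> < \<infinity> \<or>
       ((\<lambda>n::nat. ereal ((ln (ln (real n)) / ln (real n)) powr (1 / (2 * p)))
                   * poincare_modulus_N p Y dY \<sigma> n) \<longlongrightarrow> 0) sequentially"
  shows "eventually (\<lambda>n. \<exists>L\<ge>0. poincare_modulus_N p Y dY \<sigma> n = ereal L \<and>
      L powr p * sqrt (ln (ln (real n)) / ln (real n)) \<le> \<epsilon>) sequentially"
  using growth
proof
  let ?P = "poincare_modulus p Y dY \<sigma>"
  assume "?P < \<infinity>"
  then obtain B where B: "?P = ereal B" using poincare_modulus_nonneg[of p Y dY \<sigma>] by (cases ?P) auto
  have "(\<lambda>n. B powr p * sqrt (ln (ln (real n)) / ln (real n))) \<longlonglongrightarrow> B powr p * 0"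
    by (intro tendsto_mult_left sqrt_lnln_over_ln_tendsto_0)
  then have "eventually (\<lambda>n. B powr p * sqrt (ln (ln (real n)) / ln (real n)) < \<epsilon>) sequentially"
    using \<epsilon> by (intro order_tendstoD) auto
  moreover have "eventually (\<lambda>n. 1 < ln (real n)) sequentially"
    using filterlim_compose[OF ln_at_top filterlim_real_sequentially] by (simp add: filterlim_at_top_dense)
  ultimately show ?thesis
  proof eventually_elim
    case (elim n)
    obtain L where L: "poincare_modulus_N p Y dY \<sigma> n = ereal L" "0 \<le> L" "L \<le> B"
      using poincare_modulus_N_nonneg[of p Y dY \<sigma> n] poincare_modulus_N_le[of p Y dY \<sigma> n] B
      by (cases "poincare_modulus_N p Y dY \<sigma> n") auto
    have "L powr p * sqrt (ln (ln (real n)) / ln (real n)) \<le> B powr p * sqrt (ln (ln (real n)) / ln (real n))"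
      using L elim p by (intro mult_right_mono powr_mono2) auto
    then have "L powr p * sqrt (ln (ln (real n)) / ln (real n)) \<le> \<epsilon>" using elim(1) by linarith
    then show ?case using L by blast
  qed
next
  assume "((\<lambda>n::nat. ereal ((ln (ln (real n)) / ln (real n)) powr (1 / (2 * p)))
                   * poincare_modulus_N p Y dY \<sigma> n) \<longlongrightarrow> 0) sequentially"
  then have "eventually (\<lambda>n. ereal ((ln (ln (real n)) / ln (real n)) powr (1 / (2 * p)))
                   * poincare_modulus_N p Y dY \<sigma> n < ereal (\<epsilon> powr (1 / p))) sequentially"
    using \<epsilon> by (intro order_tendstoD) auto
  moreover have "eventually (\<lambda>n. 1 < ln (real n)) sequentially"
    using filterlim_compose[OF ln_at_top filterlim_real_sequentially] by (simp add: filterlim_at_top_dense)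
  ultimately show ?thesis
  proof eventually_elim
    case (elim n)
    define s where "s = ln (ln (real n)) / ln (real n)"
    define r where "r = s powr (1 / (2 * p))"
    have s: "0 < s" using elim by (simp add: s_def)
    then have "0 < r" by (simp add: r_def)
    moreover have "ereal r * poincare_modulus_N p Y dY \<sigma> n < ereal (\<epsilon> powr (1 / p))"
      using elim(1) by (simp add: r_def s_def)
    \<comment> \<open>A positive \<open>r\<close> times \<open>\<infinity>\<close> would be
      infinite, so the modulus is a real number.\<close>
    ultimately obtain L where L: "poincare_modulus_N p Y dY \<sigma> n = ereal L" "0 \<le> L"
      using poincare_modulus_N_nonneg[of p Y dY \<sigma> n]
      by (cases "poincare_modulus_N p Y dY \<sigma> n") auto
    have "s powr (1 / (2 * p)) * L < \<epsilon> powr (1 / p)" using elim(1) L by (simp add: s_def)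
    then have "(s powr (1 / (2 * p)) * L) powr p \<le> (\<epsilon> powr (1 / p)) powr p"
      using p s L by (intro powr_mono2) auto
    then have "s powr (1 / 2) * L powr p \<le> \<epsilon>"
      using p L s \<epsilon> by (simp add: powr_mult powr_powr)
    then show ?case using L s by (auto simp: s_def[symmetric] powr_half_sqrt mult.commute)
  qed
qed

section \<open>Words acting by isometries\<close>

text \<open>The words are left unreduced: a uniform one records the successive steps of the simple
  random walk.\<close>

definition words :: "nat \<Rightarrow> nat \<Rightarrow> letter list set" where
  "words k n = {w \<in> lists (gens k). length w = n}"

lemma gens_eq: "gens k = {..<k} \<times> UNIV"
  by (auto simp: gens_def)

lemma finite_gens: "finite (gens k)"
  by (simp add: gens_eq)

lemma card_gens: "card (gens k) = 2 * k"
  by (simp add: gens_eq card_cartesian_product)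

lemma words_eq: "words k n = {w. set w \<subseteq> gens k \<and> length w = n}"
  by (auto simp: words_def lists_eq_set)

lemma finite_words: "finite (words k n)"
  unfolding words_eq by (rule finite_lists_length_eq[OF finite_gens])

lemma card_words: "card (words k n) = (2 * k) ^ n"
  unfolding words_eq by (simp add: card_lists_length_eq[OF finite_gens] card_gens)

lemma inv_letter_gens [simp]: "inv_letter l \<in> gens k \<longleftrightarrow> l \<in> gens k"
  by (auto simp: inv_letter_def gens_def)

lemma inv_letter_inv_letter [simp]: "inv_letter (inv_letter l) = l"
  by (simp add: inv_letter_def)

lemma inv_word_inv_word: "inv_word (inv_word w) = w"
  by (simp add: inv_word_def rev_map comp_def)

lemma inv_word_words: "w \<in> words k n \<Longrightarrow> inv_word w \<in> words k n"
  by (auto simp: words_eq inv_word_def)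

lemma word_act_Nil [simp]: "word_act Y \<rho> [] = id"
  by (simp add: word_act_def)

lemma word_act_Cons [simp]: "word_act Y \<rho> (l # w) = letter_act Y \<rho> l \<circ> word_act Y \<rho> w"
  by (simp add: word_act_def)

lemma word_act_append: "word_act Y \<rho> (v @ w) = word_act Y \<rho> v \<circ> word_act Y \<rho> w"
  by (induction v) (auto simp: comp_assoc)

lemma reduce_in_lists: "w \<in> lists (gens k) \<Longrightarrow> reduce w \<in> lists (gens k)"
  by (induction w) (auto split: list.splits)

lemma free_group_subset_lists: "free_group k \<subseteq> lists (gens k)"
  unfolding free_group_def using reduce_in_lists by blast

text \<open>A uniform word is a sequence of independent uniform letters. The induction splits off
  the first letter, which acts last.\<close>

lemma average_pow_words:
  "(average (gens k) (letter_act Y \<rho>) ^^ n) h y = average (words k n) (word_act Y \<rho>) h y"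
proof (induction n arbitrary: h)
  case 0
  have "words k 0 = {[]}" by (auto simp: words_eq)
  then show ?case by (simp add: average_def)
next
  case (Suc n)
  have "(\<Sum>w\<in>words k (Suc n). h (word_act Y \<rho> w y))
      = (\<Sum>(w, l)\<in>words k n \<times> gens k. h (letter_act Y \<rho> l (word_act Y \<rho> w y)))"
    by (rule sum.reindex_bij_witness[of _ "\<lambda>(w, l). l # w" "\<lambda>w. (tl w, hd w)"])
      (auto simp: words_eq length_Suc_conv)
  also have "\<dots> = (\<Sum>w\<in>words k n. \<Sum>l\<in>gens k. h (letter_act Y \<rho> l (word_act Y \<rho> w y)))"
    by (simp add: sum.cartesian_product)
  finally have *: "(\<Sum>w\<in>words k (Suc n). h (word_act Y \<rho> w y))
      = (\<Sum>w\<in>words k n. \<Sum>l\<in>gens k. h (letter_act Y \<rho> l (word_act Y \<rho> w y)))" .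
  have "(average (gens k) (letter_act Y \<rho>) ^^ Suc n) h y
      = average (words k n) (word_act Y \<rho>) (average (gens k) (letter_act Y \<rho>) h) y"
    by (simp add: funpow_swap1 Suc)
  also have "\<dots> = average (words k (Suc n)) (word_act Y \<rho>) h y"
    unfolding average_def * by (simp add: card_words card_gens sum_divide_distrib[symmetric] mult_ac)
  finally show ?case .
qed

section \<open>Isometric actions of the free group and energies of orbit maps\<close>

locale isometric_letters = Metric_space Y d
  for Y :: "'y set" and d :: "'y \<Rightarrow> 'y \<Rightarrow> real" +
  fixes k :: nat and \<rho> :: "nat \<Rightarrow> 'y \<Rightarrow> 'y"
  assumes bij: "a < k \<Longrightarrow> bij_betw (\<rho> a) Y Y"
    and isometry: "\<lbrakk>a < k; x \<in> Y; y \<in> Y\<rbrakk> \<Longrightarrow> d (\<rho> a x) (\<rho> a y) = d x y"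
begin

abbreviation "act \<equiv> word_act Y \<rho>"

lemma letter_closed: "l \<in> gens k \<Longrightarrow> x \<in> Y \<Longrightarrow> letter_act Y \<rho> l x \<in> Y"
  using bij[of "fst l"] bij_betwE by (fastforce simp: letter_act_def gens_def bij_betw_def inv_into_into)

lemma letter_inv: "l \<in> gens k \<Longrightarrow> x \<in> Y \<Longrightarrow> letter_act Y \<rho> (inv_letter l) (letter_act Y \<rho> l x) = x"
  using bij[of "fst l"]
  by (auto simp: letter_act_def gens_def inv_letter_def bij_betw_def f_inv_into_f)

lemma letter_isometry:
  assumes "l \<in> gens k" "x \<in> Y" "y \<in> Y"
  shows "d (letter_act Y \<rho> l x) (letter_act Y \<rho> l y) = d x y"
proof (cases "snd l")
  case False
  then show ?thesis using assms isometry by (auto simp: letter_act_def gens_def)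
next
  case True
  let ?r = "\<rho> (fst l)" and ?i = "inv_into Y (\<rho> (fst l))"
  have "fst l < k" "?i x \<in> Y" "?i y \<in> Y" "?r (?i x) = x" "?r (?i y) = y"
    using assms bij[of "fst l"] by (auto simp: gens_def bij_betw_def inv_into_into f_inv_into_f)
  then have "d (?i x) (?i y) = d x y" using isometry by metis
  then show ?thesis using True by (simp add: letter_act_def)
qed

lemma act_closed: "w \<in> lists (gens k) \<Longrightarrow> x \<in> Y \<Longrightarrow> act w x \<in> Y"
  by (induction w) (auto simp: letter_closed)

lemma act_isometry: "w \<in> lists (gens k) \<Longrightarrow> x \<in> Y \<Longrightarrow> y \<in> Y \<Longrightarrow> d (act w x) (act w y) = d x y"
  by (induction w) (auto simp: letter_isometry act_closed)

lemma act_inv_word: "w \<in> lists (gens k) \<Longrightarrow> x \<in> Y \<Longrightarrow> act (inv_word w) (act w x) = x"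
  by (induction w) (auto simp: inv_word_def word_act_append letter_inv act_closed)

text \<open>A cancelled pair acts trivially on \<open>Y\<close>, so the action of words passes to
  the free group.\<close>

lemma act_reduce: "w \<in> lists (gens k) \<Longrightarrow> x \<in> Y \<Longrightarrow> act (reduce w) x = act w x"
proof (induction w)
  case (Cons l w)
  then have w: "w \<in> lists (gens k)" "l \<in> gens k" "act (reduce w) x = act w x" by auto
  show ?case
  proof (cases "reduce w")
    case Nil
    then show ?thesis using w by simp
  next
    case (Cons l' v)
    have "l' # v \<in> lists (gens k)" using reduce_in_lists[OF w(1)] Cons by simp
    then have "act v x \<in> Y" using \<open>x \<in> Y\<close> by (auto intro: act_closed)
    have "letter_act Y \<rho> l (letter_act Y \<rho> (inv_letter l) (act v x)) = act v x"
      using letter_inv[of "inv_letter l" "act v x"] w(2) \<open>act v x \<in> Y\<close> by simp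
    then show ?thesis using Cons w by (auto simp flip: w(3))
  qed
qed simp

text \<open>Turns a point of \<open>Y\<close> into an equivariant map, to which property
  \<open>(P_p)\<close> applies.\<close>

lemma equivariant_orbit_map:
  assumes "y \<in> Y"
  shows "equivariant k Y \<rho> (\<lambda>x. act x y)"
proof -
  have "act (fg_mult g x) y = act g (act x y)" if "g \<in> free_group k" "x \<in> free_group k" for g x
    using that free_group_subset_lists[of k] assms unfolding fg_mult_def
    by (subst act_reduce) (auto simp: word_act_append)
  then show ?thesis
    using assms free_group_subset_lists[of k] act_closed unfolding equivariant_def by blast
qed

text \<open>\<open>mu_pow\<close> counts the words with a given reduced form, so grouping the sum
  over all words by \<open>reduce\<close> yields the energy.\<close>

lemma energy_orbit_map:
  assumes "y \<in> Y" "0 < k"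
  shows "energy k p d (mu_pow k n) (\<lambda>x. act x y)
    = 1 / 2 * average (words k n) act (\<lambda>u. d y u powr p) y"
proof -
  let ?g = "\<lambda>x. d y (act x y) powr p"
  have mu: "mu_pow k n x = real (card {w \<in> words k n. reduce w = x}) / real (card (words k n))" for x
    by (simp add: mu_pow_def card_words) (simp add: words_def)
  have supp: "{x \<in> free_group k. mu_pow k n x \<noteq> 0} = reduce ` words k n"
  proof -
    have "finite {w \<in> words k n. reduce w = x}" for x using finite_words by simp
    then have "mu_pow k n x \<noteq> 0 \<longleftrightarrow> x \<in> reduce ` words k n" for x
      using assms(2) by (auto simp: mu card_words card_eq_0_iff)
    moreover have "reduce ` words k n \<subseteq> free_group k" by (auto simp: words_def free_group_def)
    ultimately show ?thesis by blast
  qed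
  have "(\<Sum>x\<in>reduce ` words k n. mu_pow k n x * ?g x)
      = (\<Sum>x\<in>reduce ` words k n. \<Sum>w\<in>{w. w \<in> words k n \<and> reduce w = x}. ?g (reduce w)) / real (card (words k n))"
    by (simp add: mu sum_divide_distrib)
  also have "\<dots> = (\<Sum>w\<in>words k n. ?g (reduce w)) / real (card (words k n))"
    by (subst sum.image_gen[OF finite_words, of _ k n reduce]) simp
  also have "\<dots> = average (words k n) act (\<lambda>u. d y u powr p) y"
    unfolding average_def using assms(1) by (simp add: act_reduce words_def)
  finally show ?thesis
    unfolding energy_def supp by simp
qed

end

section \<open>The walk by words of even length and fixed points\<close>

locale uniformly_convex_action = uniformly_convex_space Y d p \<kappa> + isometric_letters Y d k \<rho>
  for Y :: "'y set" and d :: "'y \<Rightarrow> 'y \<Rightarrow> real" and p \<kappa> :: real and k :: nat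
    and \<rho> :: "nat \<Rightarrow> 'y \<Rightarrow> 'y" +
  fixes j :: nat
  assumes k_pos: "0 < k" and j_even: "even j" and j_pos: "0 < j"
begin

text \<open>These supply a trivially acting word of every even length; \<open>n = j div 2\<close>
  gives the step \<open>w0\<close>.\<close>

definition trivial_word :: "nat \<Rightarrow> letter list" where
  "trivial_word n = concat (replicate n [(0, False), (0, True)])"

lemma trivial_word_lists: "trivial_word n \<in> lists (gens k)"
  using k_pos by (induction n) (auto simp: trivial_word_def gens_def)

lemma length_trivial_word: "length (trivial_word n) = 2 * n"
  by (induction n) (auto simp: trivial_word_def)

lemma act_trivial_word: "x \<in> Y \<Longrightarrow> act (trivial_word n) x = x"
proof (induction n)
  case (Suc n)
  then show ?case
    using letter_inv[of "(0, True)" x] k_pos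
    by (simp add: trivial_word_def inv_letter_def gens_def)
qed (simp add: trivial_word_def)

sublocale walk: isometric_walk Y d p \<kappa> "words k j" act inv_word "trivial_word (j div 2)"
proof
  show "finite (words k j)" by (rule finite_words)
  show "trivial_word (j div 2) \<in> words k j"
    using trivial_word_lists length_trivial_word j_even by (auto simp: words_def)
  have "2 ^ 1 \<le> (2 * k) ^ 1" using k_pos by simp
  also have "\<dots> \<le> (2 * k) ^ j" using k_pos j_pos by (intro power_increasing) auto
  finally show "2 \<le> card (words k j)" by (simp add: card_words)
  fix w assume w: "w \<in> words k j"
  then have wl: "w \<in> lists (gens k)" "inv_word w \<in> lists (gens k)"
    using inv_word_words by (auto simp: words_def)
  show "inv_word w \<in> words k j" using w by (rule inv_word_words)
  show "inv_word (inv_word w) = w" by (rule inv_word_inv_word)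
  fix x assume x: "x \<in> Y"
  show "act w x \<in> Y" using wl x act_closed by blast
  fix y assume y: "y \<in> Y"
  show "d (act w x) (act w y) = d x y" using wl x y act_isometry by blast
  have "d (act w x) y = d (act (inv_word w) (act w x)) (act (inv_word w) y)"
    using wl x y act_isometry act_closed by simp
  then show "d (act w x) y = d x (act (inv_word w) y)" using act_inv_word wl x by simp
next
  fix x assume "x \<in> Y"
  then show "act (trivial_word (j div 2)) x = x" by (rule act_trivial_word)
qed

text \<open>Concatenating \<open>m\<close> uniform words of length \<open>j\<close> gives a uniform
  word of length \<open>j * m\<close>. The factor 2 cancels the \<open>1 / 2\<close> in
  \<open>energy\<close>.\<close>

lemma potential_eq_energy:
  assumes "y \<in> Y"
  shows "walk.potential m y y = 2 * energy k p d (mu_pow k (j * m)) (\<lambda>x. act x y)"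
proof -
  have "average (words k j) act = average (gens k) (letter_act Y \<rho>) ^^ j"
    by (intro ext) (simp add: average_pow_words)
  then have "average (words k j) act ^^ m = average (gens k) (letter_act Y \<rho>) ^^ (j * m)"
    by (simp add: funpow_mult)
  then show ?thesis
    using assms k_pos by (simp add: walk.potential_def energy_orbit_map average_pow_words)
qed

text \<open>Vanishing energy only makes \<open>x\<close> fixed by the words of even length; its orbit then has at most
  two points, and their barycenter is fixed by everything.\<close>
lemma fixed_point_of_energy1_zero:
  assumes x: "x \<in> Y" and energy0: "walk.energy1 x = 0"
  obtains b where "b \<in> Y" "\<And>w. w \<in> lists (gens k) \<Longrightarrow> act w b = b"
proof -
  let ?A = "letter_act Y \<rho>"
  have fixed: "act w x = x" if "w \<in> words k j" for w
  proof -
    have "d x (act w x) \<le> 0"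
      using walk.displacement_le_energy1[OF that, of x] energy0 by simp
    then show ?thesis using x walk.act_closed[OF that x] by (metis mdist_pos_less not_less)
  qed
  have two: "?A l (?A l' x) = x" if "l \<in> gens k" "l' \<in> gens k" for l l'
  proof -
    \<comment> \<open>Two letters are padded by a trivial word to length \<open>j\<close>.\<close>
    have "[l, l'] @ trivial_word (j div 2 - 1) \<in> words k j"
      using that trivial_word_lists length_trivial_word j_even j_pos by (auto simp: words_def elim!: evenE)
    from fixed[OF this] show ?thesis
      using x by (simp add: word_act_append act_trivial_word)
  qed
  define s where "s = ((0, False) :: letter)"
  have s: "s \<in> gens k" using k_pos by (simp add: s_def gens_def)
  define x' where "x' = ?A s x"
  have x': "x' \<in> Y" using letter_closed s x by (simp add: x'_def)
  have swap1: "?A l x' = x" if "l \<in> gens k" for l using two[OF that s] by (simp add: x'_def)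
  have swap2: "?A l x = x'" if l: "l \<in> gens k" for l
  proof -
    \<comment> \<open>Inserting \<open>s\<close> and its inverse before \<open>l\<close> leaves two
      letters acting on \<open>x\<close>, which fix it; hence all letters send \<open>x\<close> to
      the same point.\<close>
    have "?A s (?A (inv_letter s) (?A l x)) = ?A l x"
      using letter_inv[of "inv_letter s" "?A l x"] s letter_closed[OF l x] by simp
    moreover have "?A (inv_letter s) (?A l x) = x" using two l s by simp
    ultimately show ?thesis by (simp add: x'_def)
  qed
  \<comment> \<open>Indexing by \<open>bool\<close> gives \<open>x\<close> and \<open>x'\<close>
    weight 1/2 each even when they coincide.\<close>
  define V where "V z = (\<Sum>i\<in>UNIV. d z (if i then x else x') powr p) / real (card (UNIV :: bool set))" for z
  have V: "V z = (d z x powr p + d z x' powr p) / 2" for z by (simp add: V_def UNIV_bool)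
  have "seq_continuous V"
    unfolding V_def[abs_def] by (rule seq_continuous_average) (simp add: x x' dist_powr_seq_continuous_uniformly_convex)
  moreover have "uniformly_convex V"
    unfolding V_def[abs_def] by (rule uniformly_convex_average) (simp_all add: x x' dist_powr_seq_continuous_uniformly_convex)
  moreover have "0 \<le> V z" for z by (simp add: V)
  ultimately obtain b where b: "b \<in> Y" "\<And>y. y \<in> Y \<Longrightarrow> V b + \<kappa> * d b y powr p \<le> V y"
    using barycenter_exists[of V] by blast
  have letter: "?A l b = b" if l: "l \<in> gens k" for l
  proof -
    have lb: "?A l b \<in> Y" using letter_closed l b by blast
    \<comment> \<open>Each letter interchanges \<open>x\<close> and \<open>x'\<close>, so
      \<open>V\<close> takes the same value at \<open>b\<close> and at its image, and the minimiser
      is unique.\<close>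
    have "d (?A l b) x = d b x'" "d (?A l b) x' = d b x"
      using letter_isometry[OF l b(1) x] letter_isometry[OF l b(1) x'] swap1[OF l] swap2[OF l] by auto
    then have "V (?A l b) = V b" by (simp add: V)
    then have "\<kappa> * d b (?A l b) powr p \<le> 0" using b(2)[OF lb] by simp
    then have "d b (?A l b) powr p = 0"
      using \<kappa>_pos by (smt (verit) mult_pos_pos powr_ge_zero)
    then show ?thesis using lb b(1) by simp
  qed
  have "act w b = b" if "w \<in> lists (gens k)" for w
    using that by (induction w) (auto simp: letter)
  then show ?thesis using that b(1) by blast
qed

end

section \<open>Existence of the fixed point\<close>

theorem theorem7p6:
  fixes N :: "nat \<Rightarrow> nat" and E :: "nat \<Rightarrow> nat \<Rightarrow> nat \<Rightarrow> bool"
    and D :: nat and c \<sigma> p :: real and k j :: nat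
    and \<alpha> :: "nat \<Rightarrow> nat \<Rightarrow> nat \<Rightarrow> letter list"
    and Y :: "'y set" and dY :: "'y \<Rightarrow> 'y \<Rightarrow> real" and \<rho> :: "nat \<Rightarrow> 'y \<Rightarrow> 'y"
  assumes N_to_inf: "filterlim N at_top sequentially"
    and graphs: "\<forall>i. simple_graph (N i) (E i)"
    and conn: "\<forall>i. graph_connected (N i) (E i)"
    and nonbip: "\<forall>i. \<not> bipartite (N i) (E i)"
    and degs: "\<forall>i u. u < N i \<longrightarrow> 3 \<le> degree (N i) (E i) u \<and> degree (N i) (E i) u \<le> D"
    and gaps: "\<forall>i. \<sigma> \<le> spectral_gap {..<N i} (srw (N i) (E i))"
    and c_pos: "0 < c"
    and girth: "\<forall>i vs. is_cycle (N i) (E i) vs \<longrightarrow> c * ln (real (N i)) \<le> real (cycle_length vs)"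
    and sigma_pos: "0 < \<sigma>"
    and p_ge: "2 \<le> p"
    and j_even: "even j" and j_pos: "0 < j"
    and lab: "labeling k j N E \<alpha>"
    and PP: "prop_P p \<sigma> k j N E \<alpha> TYPE('y)"
    and metric: "Metric_space Y dY"
    and complete: "Metric_space.mcomplete Y dY"
    and nonempty: "Y \<noteq> {}"
    and geod: "geodesic_space Y dY"
    and unif_conv: "p_uniformly_convex p Y dY"
    and growth: "poincare_modulus p Y dY \<sigma> < \<infinity> \<or>
       ((\<lambda>n::nat. ereal ((ln (ln (real n)) / ln (real n)) powr (1 / (2 * p)))
                   * poincare_modulus_N p Y dY \<sigma> n) \<longlongrightarrow> 0) sequentially"
    and action: "alpha_action k N E \<alpha> Y dY \<rho>"
  shows "\<exists>y\<in>Y. \<forall>g\<in>free_group k. word_act Y \<rho> g y = y"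
proof (cases "k = 0")
  case True
  \<comment> \<open>Without generators the group is trivial and every point is fixed.\<close>
  then have "free_group k = {[]}" by (auto simp: free_group_def gens_def)
  then show ?thesis using nonempty by auto
next
  case False
  obtain cY where cY: "0 < cY" and conv: "\<forall>x\<in>Y. \<forall>y\<in>Y. \<forall>z\<in>Y. \<forall>\<gamma>. geodesic Y dY \<gamma> y z \<longrightarrow>
     (\<forall>t\<in>{0..1}. dY x (\<gamma> t) powr p \<le> (1 - t) * dY x y powr p + t * dY x z powr p
                     - cY powr p * t * (1 - t) * dY y z powr p)"
    using unif_conv unfolding p_uniformly_convex_def by blast
  have acts: "\<And>a. a < k \<Longrightarrow> bij_betw (\<rho> a) Y Y"
    "\<And>a x y. a < k \<Longrightarrow> x \<in> Y \<Longrightarrow> y \<in> Y \<Longrightarrow> dY (\<rho> a x) (\<rho> a y) = dY x y"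
    using action unfolding alpha_action_def by blast+
  interpret Metric_space Y dY by (rule metric)
  interpret uniformly_convex_action Y dY p "cY powr p" k \<rho> j
  proof
    fix x y z \<gamma> and t :: real
    assume "x \<in> Y" "y \<in> Y" "z \<in> Y" "geodesic Y dY \<gamma> y z" "t \<in> {0..1}"
    then show "dY x (\<gamma> t) powr p \<le> (1 - t) * dY x y powr p + t * dY x z powr p
                     - cY powr p * t * (1 - t) * dY y z powr p"
      using conv by blast
  qed (use p_ge cY complete nonempty geod acts False j_even j_pos in auto)
  obtain a b K where abK: "0 < a" "0 < b" "0 < K"
    and P: "\<And>M. \<exists>i. M \<le> N i \<and> (\<forall>f. equivariant k Y \<rho> f \<longrightarrow>
              (\<exists>m::nat. a * ln (real (N i)) \<le> real m \<and> real m \<le> b * ln (real (N i)) \<and>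
                 (\<forall>L. poincare_modulus_N p Y dY \<sigma> (N i) = ereal L \<longrightarrow>
                    energy k p dY (mu_pow k (j * m)) f
                      \<le> K * L powr p * energy k p dY (mu_pow k j) f)))"
    using PP metric action unfolding prop_P_def
    by (elim exE conjE) (drule spec[of _ Y], drule spec[of _ dY], drule spec[of _ \<rho>], blast)
  obtain x where "x \<in> Y" "walk.energy1 x = 0"
  proof (rule walk.energy1_zero_exists[OF abK])
    fix \<epsilon> :: real and M :: nat
    assume "0 < \<epsilon>"
    then obtain M' where M': "\<And>n. M' \<le> n \<Longrightarrow> \<exists>L\<ge>0. poincare_modulus_N p Y dY \<sigma> n = ereal L \<and>
      L powr p * sqrt (ln (ln (real n)) / ln (real n)) \<le> \<epsilon>"
      using poincare_modulus_N_growth[OF _ _ growth, of \<epsilon>] p_ge by (auto simp: eventually_sequentially)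
    \<comment> \<open>\<open>N i\<close> lies beyond both the demanded \<open>M\<close> and the
      threshold \<open>M'\<close> of the growth estimate, and is fixed before any
      \<open>y\<close>.\<close>
    obtain i where i: "max M M' \<le> N i" and f: "\<And>f. equivariant k Y \<rho> f \<Longrightarrow>
              (\<exists>m::nat. a * ln (real (N i)) \<le> real m \<and> real m \<le> b * ln (real (N i)) \<and>
                 (\<forall>L. poincare_modulus_N p Y dY \<sigma> (N i) = ereal L \<longrightarrow>
                    energy k p dY (mu_pow k (j * m)) f
                      \<le> K * L powr p * energy k p dY (mu_pow k j) f))"
      using P[of "max M M'"] by blast
    obtain L where L: "poincare_modulus_N p Y dY \<sigma> (N i) = ereal L"
      "L powr p * sqrt (ln (ln (real (N i))) / ln (real (N i))) \<le> \<epsilon>"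
      using M'[of "N i"] i by auto
    have "\<exists>m::nat. a * ln (real (N i)) \<le> real m \<and> real m \<le> b * ln (real (N i)) \<and>
         walk.potential m y y \<le> K * (L powr p) * walk.energy1 y" if y: "y \<in> Y" for y
    proof -
      \<comment> \<open>Only \<open>m\<close> depends on \<open>y\<close>; it comes from
        \<open>(P_p)\<close> for the orbit map of \<open>y\<close>.\<close>
      obtain m :: nat where "a * ln (real (N i)) \<le> real m" "real m \<le> b * ln (real (N i))"
        "energy k p dY (mu_pow k (j * m)) (\<lambda>x. act x y)
          \<le> K * L powr p * energy k p dY (mu_pow k j) (\<lambda>x. act x y)"
        using f[OF equivariant_orbit_map[OF y]] L(1) by blast
      then show ?thesis
        by (intro exI[of _ m]) (simp add: walk.energy1_def potential_eq_energy[OF y])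
    qed
    then show "\<exists>N \<Lambda>. M \<le> N \<and> 0 \<le> \<Lambda> \<and>
      \<Lambda> * sqrt (ln (ln (real N)) / ln (real N)) \<le> \<epsilon> \<and>
      (\<forall>y\<in>Y. \<exists>m::nat. a * ln (real N) \<le> real m \<and> real m \<le> b * ln (real N) \<and>
         walk.potential m y y \<le> K * \<Lambda> * walk.energy1 y)"
      using i L(2) by (intro exI[of _ "N i"] exI[of _ "L powr p"]) auto
  qed
  then obtain y where "y \<in> Y" "\<And>w. w \<in> lists (gens k) \<Longrightarrow> act w y = y"
    using fixed_point_of_energy1_zero by blast
  then show ?thesis using free_group_subset_lists[of k] by blast
qed

end
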